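(* Let $\nu>0$, $T>0$, let $\Omega\subset\mathbb{R}^d$, $d\ge2$, be a domain and let $u\in L^\infty(0,T;L^2(\Omega))\cap L^2(0,T;H^1(\Omega))$ be a Leray--Hopf weak solution to the incompressible Navier--Stokes equations with viscosity $\nu$ and pressure $p$, having non-negative local dissipation measure $D[u]\in\mathcal{M}_{\rm loc}(\Omega\times(0,T))$. For $\alpha>0$ and $3\le r,q\le\infty$ define $$s=\min\left(d\,\frac{r-2}{r}-\alpha\frac2q,\ -1+d\,\frac{r-3}{r}+\alpha\frac{q-3}{q},\ -2+d\,\frac{r-2}{r}+\alpha\frac{q-2}{q}\right).$$ Assume that $s\ge0$, $u\in L^q_{\rm loc}(0,T;L^r_{\rm loc}(\Omega))$ and $p\in L^{q/2}_{\rm loc}(0,T;L^{r/2}_{\rm loc}(\Omega))$. Then: (i) If $q<\infty$, then for every Borel set $B\subset\subset\Omega\times(0,T)$, $$\mathcal{H}^s_\alpha(B)<\infty\ \Rightarrow\ D[u](B)=0,$$ with the convention that $s=\min\left(d-\alpha\frac2q,\ d-1+\alpha\frac{q-3}{q},\ d-2+\alpha\frac{q-2}{q}\right)$ whenever $r=\infty$. (ii) If $q=\infty$, then $$D[u]\ll\mathcal{H}^s_\alpha\qquad\text{for } s=\min\left(d\,\frac{r-2}{r},\ -1+d\,\frac{r-3}{r}+\alpha,\ -2+d\,\frac{r-2}{r}+\alpha\right),$$ with the convention that $s=\min(d,\ d-2+\alpha)$ whenever $r=\infty$. In particular, if $D[u]\not\equiv0$ is concentrated on a space-time set $S$, then $\dim_{\mathcal{H}_\alpha}S\ge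 s$.
   Context: Navier--Stokes equations: $\partial_tu+(u\cdot\nabla)u=-\nabla p+\nu\Delta u$, $\operatorname{div}u=0$ in $\Omega\times(0,T)$, with no-slip condition $u=0$ on $\partial\Omega\times(0,T)$ if $\Omega$ has a boundary (boundaries are assumed smooth). A Leray--Hopf weak solution is a distributional solution in $L^\infty(0,T;L^2(\Omega))\cap L^2(0,T;H^1(\Omega))$ (with zero trace if there is a boundary) attaining an $L^2$ divergence-free initial datum and satisfying the global energy inequality; $p$ is the associated pressure. Dissipation distribution: $D[u]$ is the distribution on $\Omega\times(0,T)$ defined by the local energy identity $$\partial_t\frac{|u|^2}{2}+\operatorname{div}\Big(\Big(\frac{|u|^2}{2}+p\Big)u\Big)-\nu\Delta\frac{|u|^2}{2}=-D[u]-\nu|\nabla u|^2 .$$ $\mathcal{M}_{\rm loc}(X)$ denotes locally finite Borel (Radon) measures on $X$; $B\subset\subset X$ means that the closure of $B$ is compact and contained in $X$. Anisotropic Hausdorff measure: for $\alpha\ge0$, $\delta>0$, let $\mathcal{C}^\alpha_\delta(x,t)=B_\delta(x)\times(t-\delta^\alpha,t+\delta^\alpha)\subset\mathbb{R}^d\times\mathbb{R}$. For $s\ge0$, $\mathcal{H}^s_\alpha$ is the measure obtained by Carathéodory's construction from the family of all such cylinders with gauge $\Psi^s(\mathcal{C}^\alpha_\delta(x,t))=\delta^s$, i.e. $\mathcal{H}^s_\alpha(A)=\lim_{\rho\to0^+}\inf\{\sum_i r_i^s\}$, the infimum over at most countable covers $\{\mathcal{C}^\alpha_{r_i}(x_i,t_i)\}_i$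 of $A$ by cylinders of diameter $\le\rho$. For a Borel set $A$, $\dim_{\mathcal{H}_\alpha}(A)=\inf\{s\ge0:\mathcal{H}^s_\alpha(A)=0\}$. A measure $\mu$ is concentrated on a (Borel) set $S$ if $\mu(A)=\mu(A\cap S)$ for all measurable $A$. $\mu\ll\mathcal{H}^s_\alpha$ means $\mathcal{H}^s_\alpha(A)=0\Rightarrow\mu(A)=0$ for Borel $A\subset\Omega\times(0,T)$. *)

theory Defs
  imports "HOL-Analysis.Analysis" "HOL-Probability.Essential_Supremum"
begin

definition ddir :: "'a::real_normed_vector \<Rightarrow> ('a \<Rightarrow> 'b::real_normed_vector) \<Rightarrow> 'a \<Rightarrow> 'b" where
  "ddir v f = (\<lambda>x. frechet_derivative f (at x) v)"

text \<open>On a finite-dimensional space \<open>C_k n\<close> is the class of n times continuously differentiable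
  functions.\<close>

primrec C_k :: "nat \<Rightarrow> ('a::real_normed_vector \<Rightarrow> 'b::real_normed_vector) \<Rightarrow> bool" where
  "C_k 0 f \<longleftrightarrow> continuous_on UNIV f"
| "C_k (Suc n) f \<longleftrightarrow> (\<forall>x. f differentiable (at x)) \<and> (\<forall>v. C_k n (ddir v f))"

definition smooth :: "('a::real_normed_vector \<Rightarrow> 'b::real_normed_vector) \<Rightarrow> bool" where
  "smooth f \<longleftrightarrow> (\<forall>n. C_k n f)"

definition test_function :: "'a::real_normed_vector set \<Rightarrow> ('a \<Rightarrow> 'b::real_normed_vector) \<Rightarrow> bool" where
  "test_function W \<phi> \<longleftrightarrow>
     smooth \<phi> \<and> compact (closure {x. \<phi> x \<noteq> 0}) \<and> closure {x. \<phi> x \<noteq> 0} \<subseteq> W"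

text \<open>Space-time points are pairs \<open>(x, t)\<close>.\<close>

definition dt :: "((real^'d) \<times> real \<Rightarrow> 'b::real_normed_vector) \<Rightarrow> (real^'d) \<times> real \<Rightarrow> 'b" where
  "dt f = ddir (0, 1) f"

definition dx :: "'d \<Rightarrow> ((real^'d) \<times> real \<Rightarrow> 'b::real_normed_vector) \<Rightarrow> (real^'d) \<times> real \<Rightarrow> 'b" where
  "dx i f = ddir (axis i 1, 0) f"

definition laplacian_x :: "((real^'d) \<times> real \<Rightarrow> 'b::real_normed_vector) \<Rightarrow> (real^'d) \<times> real \<Rightarrow> 'b" where
  "laplacian_x f z = (\<Sum>i\<in>UNIV. dx i (dx i f) z)"

definition grad_x :: "((real^'d) \<times> real \<Rightarrow> real) \<Rightarrow> (real^'d) \<times> real \<Rightarrow> real^'d" where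
  "grad_x f z = (\<chi> i. dx i f z)"

definition div_x :: "((real^'d) \<times> real \<Rightarrow> real^'d) \<Rightarrow> (real^'d) \<times> real \<Rightarrow> real" where
  "div_x f z = (\<Sum>i\<in>UNIV. dx i f z $ i)"

text \<open>The boundary is locally the zero set of a smooth function with non-vanishing differential,
  the domain lying on one side of it. The condition is void if the boundary is empty.\<close>

definition smooth_boundary :: "(real^'d) set \<Rightarrow> bool" where
  "smooth_boundary \<Omega> \<longleftrightarrow>
     (\<forall>x\<in>frontier \<Omega>. \<exists>U (g :: real^'d \<Rightarrow> real). open U \<and> x \<in> U \<and> smooth g \<and>
        (\<forall>y\<in>U. frechet_derivative g (at y) \<noteq> (\<lambda>_. 0)) \<and> \<Omega> \<inter> U = {y \<in> U. g y < 0})"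

definition smooth_domain :: "(real^'d) set \<Rightarrow> bool" where
  "smooth_domain \<Omega> \<longleftrightarrow> open \<Omega> \<and> connected \<Omega> \<and> \<Omega> \<noteq> {} \<and> smooth_boundary \<Omega>"

definition ennreal_pow :: "ennreal \<Rightarrow> real \<Rightarrow> ennreal" where
  "ennreal_pow x a = (if x = top then top else ennreal (enn2real x powr a))"

text \<open>The (possibly infinite) \<open>L\<^sup>p\<close> norm of a nonnegative function, for \<open>0 < p \<le> \<infinity>\<close>.\<close>

definition Lp_norm :: "'a measure \<Rightarrow> ereal \<Rightarrow> ('a \<Rightarrow> ennreal) \<Rightarrow> ennreal" where
  "Lp_norm M p g =
     (if p = \<infinity> then esssup M g
      else ennreal_pow (\<integral>\<^sup>+x. ennreal_pow (g x) (real_of_ereal p) \<partial>M) (1 / real_of_ereal p))"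

definition in_Lp :: "'a::euclidean_space set \<Rightarrow> ereal \<Rightarrow> ('a \<Rightarrow> 'b::real_normed_vector) \<Rightarrow> bool" where
  "in_Lp A p f \<longleftrightarrow> set_borel_measurable lborel A f \<and>
     Lp_norm (restrict_space lborel A) p (\<lambda>x. ennreal (norm (f x))) < \<infinity>"

text \<open>\<open>in_LqLr I A q r f\<close> is \<open>f \<in> L\<^sup>q(I; L\<^sup>r(A))\<close>, with \<open>q\<close> the exponent in time.\<close>

definition in_LqLr ::
  "real set \<Rightarrow> (real^'d) set \<Rightarrow> ereal \<Rightarrow> ereal \<Rightarrow> ((real^'d) \<times> real \<Rightarrow> 'b::real_normed_vector) \<Rightarrow> bool" where
  "in_LqLr I A q r f \<longleftrightarrow> set_borel_measurable lborel (A \<times> I) f \<and>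
     Lp_norm (restrict_space lborel I) q
       (\<lambda>t. Lp_norm (restrict_space lborel A) r (\<lambda>x. ennreal (norm (f (x, t))))) < \<infinity>"

definition in_LqLr_loc ::
  "real set \<Rightarrow> (real^'d) set \<Rightarrow> ereal \<Rightarrow> ereal \<Rightarrow> ((real^'d) \<times> real \<Rightarrow> 'b::real_normed_vector) \<Rightarrow> bool" where
  "in_LqLr_loc I A q r f \<longleftrightarrow> set_borel_measurable lborel (A \<times> I) f \<and>
     (\<forall>J K. compact J \<and> J \<subseteq> I \<and> compact K \<and> K \<subseteq> A \<longrightarrow> in_LqLr J K q r f)"

definition locally_integrable ::
  "'a::euclidean_space set \<Rightarrow> ('a \<Rightarrow> 'b::euclidean_space) \<Rightarrow> bool" where
  "locally_integrable W f \<longleftrightarrow> set_borel_measurable lborel W f \<and>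
     (\<forall>K. compact K \<and> K \<subseteq> W \<longrightarrow> set_integrable lborel K f)"

text \<open>The gradient of a vector field is the matrix \<open>G\<close> with \<open>G $ i $ j = \<partial>\<^sub>j v\<^sub>i\<close>; its norm in
  \<^typ>\<open>real^'d^'d\<close> is the Frobenius norm.\<close>

definition weak_gradient :: "(real^'d) set \<Rightarrow> (real^'d \<Rightarrow> real^'d) \<Rightarrow> (real^'d \<Rightarrow> real^'d^'d) \<Rightarrow> bool" where
  "weak_gradient W v G \<longleftrightarrow> locally_integrable W v \<and> locally_integrable W G \<and>
     (\<forall>\<phi> i j. test_function W \<phi> \<longrightarrow>
        (LINT x:W|lborel. v x $ i * ddir (axis j 1) \<phi> x) = - (LINT x:W|lborel. G x $ i $ j * \<phi> x))"

text \<open>A field \<open>v \<in> H\<^sup>1(\<Omega>)\<close> with weak gradient \<open>G\<close> has zero trace if it lies in \<open>H\<^sub>0\<^sup>1(\<Omega>)\<close>, the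
  closure of the test functions in \<open>H\<^sup>1(\<Omega>)\<close>.\<close>

definition zero_trace :: "(real^'d) set \<Rightarrow> (real^'d \<Rightarrow> real^'d) \<Rightarrow> (real^'d \<Rightarrow> real^'d^'d) \<Rightarrow> bool" where
  "zero_trace \<Omega> v G \<longleftrightarrow>
     (\<exists>w :: nat \<Rightarrow> real^'d \<Rightarrow> real^'d. (\<forall>n. test_function \<Omega> (w n)) \<and>
        (\<lambda>n. \<integral>\<^sup>+x\<in>\<Omega>. ennreal ((norm (w n x - v x))\<^sup>2 + (norm (jacobian (w n) (at x) - G x))\<^sup>2) \<partial>lborel)
          \<longlonglongrightarrow> 0)"

text \<open>Both equations are tested on \<open>\<Omega> \<times> (0,T)\<close>; the convective term is \<open>div (u \<otimes> u)\<close>.\<close>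

definition navier_stokes_distributional ::
  "real \<Rightarrow> (real^'d) set \<Rightarrow> real \<Rightarrow> ((real^'d) \<times> real \<Rightarrow> real^'d) \<Rightarrow> ((real^'d) \<times> real \<Rightarrow> real) \<Rightarrow> bool" where
  "navier_stokes_distributional \<nu> \<Omega> T u p \<longleftrightarrow>
     (\<forall>\<psi> :: (real^'d) \<times> real \<Rightarrow> real^'d. test_function (\<Omega> \<times> {0<..<T}) \<psi> \<longrightarrow>
        (LINT z:\<Omega> \<times> {0<..<T}|lborel.
            u z \<bullet> dt \<psi> z + (\<Sum>j\<in>UNIV. u z $ j * (u z \<bullet> dx j \<psi> z))
            + p z * div_x \<psi> z + \<nu> * (u z \<bullet> laplacian_x \<psi> z)) = 0) \<and>
     (\<forall>\<phi> :: (real^'d) \<times> real \<Rightarrow> real. test_function (\<Omega> \<times> {0<..<T}) \<phi> \<longrightarrow>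
        (LINT z:\<Omega> \<times> {0<..<T}|lborel. u z \<bullet> grad_x \<phi> z) = 0)"

text \<open>\<open>Du\<close> is the spatial weak gradient of \<open>u\<close>, so that the first four clauses say
  \<open>u \<in> L\<^sup>\<infinity>(0,T; L\<^sup>2(\<Omega>)) \<inter> L\<^sup>2(0,T; H\<^sup>1(\<Omega>))\<close>. The initial datum \<open>u0\<close> is attained weakly in
  \<open>L\<^sup>2(\<Omega>)\<close> as \<open>t\<close> tends to 0 outside a null set of times; together with the energy inequality this
  gives strong convergence.\<close>

definition leray_hopf ::
  "real \<Rightarrow> (real^'d) set \<Rightarrow> real \<Rightarrow> ((real^'d) \<times> real \<Rightarrow> real^'d) \<Rightarrow> ((real^'d) \<times> real \<Rightarrow> real^'d^'d)
    \<Rightarrow> ((real^'d) \<times> real \<Rightarrow> real) \<Rightarrow> bool" where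
  "leray_hopf \<nu> \<Omega> T u Du p \<longleftrightarrow>
     in_LqLr {0<..<T} \<Omega> \<infinity> 2 u \<and>
     in_LqLr {0<..<T} \<Omega> 2 2 u \<and>
     in_LqLr {0<..<T} \<Omega> 2 2 Du \<and>
     (AE t in lborel. t \<in> {0<..<T} \<longrightarrow> weak_gradient \<Omega> (\<lambda>x. u (x, t)) (\<lambda>x. Du (x, t))) \<and>
     (frontier \<Omega> \<noteq> {} \<longrightarrow>
        (AE t in lborel. t \<in> {0<..<T} \<longrightarrow> zero_trace \<Omega> (\<lambda>x. u (x, t)) (\<lambda>x. Du (x, t)))) \<and>
     locally_integrable (\<Omega> \<times> {0<..<T}) p \<and>
     navier_stokes_distributional \<nu> \<Omega> T u p \<and>
     (\<exists>u0 :: real^'d \<Rightarrow> real^'d.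
        in_Lp \<Omega> 2 u0 \<and>
        (\<forall>\<phi> :: real^'d \<Rightarrow> real. test_function \<Omega> \<phi> \<longrightarrow>
           (LINT x:\<Omega>|lborel. \<Sum>i\<in>UNIV. u0 x $ i * ddir (axis i 1) \<phi> x) = 0) \<and>
        (\<forall>\<psi> :: real^'d \<Rightarrow> real^'d. in_Lp \<Omega> 2 \<psi> \<longrightarrow>
           (\<forall>\<epsilon>>0. \<exists>\<delta>>0. AE t in lborel. 0 < t \<and> t < \<delta> \<and> t < T \<longrightarrow>
              \<bar>(LINT x:\<Omega>|lborel. u (x, t) \<bullet> \<psi> x) - (LINT x:\<Omega>|lborel. u0 x \<bullet> \<psi> x)\<bar> < \<epsilon>)) \<and>
        (AE t in lborel. t \<in> {0<..<T} \<longrightarrow>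
           (1/2) * (LINT x:\<Omega>|lborel. (norm (u (x, t)))\<^sup>2)
             + \<nu> * (LINT z:\<Omega> \<times> {0<..<t}|lborel. (norm (Du z))\<^sup>2)
           \<le> (1/2) * (LINT x:\<Omega>|lborel. (norm (u0 x))\<^sup>2)))"

text \<open>The pairing of \<open>D[u]\<close> with \<open>\<phi>\<close>, all derivatives in the local energy identity
  \<open>D[u] = - \<partial>\<^sub>t (\<bar>u\<bar>\<^sup>2/2) - div ((\<bar>u\<bar>\<^sup>2/2 + p) u) + \<nu> \<Delta> (\<bar>u\<bar>\<^sup>2/2) - \<nu> \<bar>Du\<bar>\<^sup>2\<close> being moved to \<open>\<phi>\<close>.\<close>

definition dissipation ::
  "real \<Rightarrow> (real^'d) set \<Rightarrow> real \<Rightarrow> ((real^'d) \<times> real \<Rightarrow> real^'d) \<Rightarrow> ((real^'d) \<times> real \<Rightarrow> real^'d^'d)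
    \<Rightarrow> ((real^'d) \<times> real \<Rightarrow> real) \<Rightarrow> ((real^'d) \<times> real \<Rightarrow> real) \<Rightarrow> real" where
  "dissipation \<nu> \<Omega> T u Du p \<phi> =
     (LINT z:\<Omega> \<times> {0<..<T}|lborel.
        (norm (u z))\<^sup>2 / 2 * dt \<phi> z
        + ((norm (u z))\<^sup>2 / 2 + p z) * (u z \<bullet> grad_x \<phi> z)
        + \<nu> * ((norm (u z))\<^sup>2 / 2) * laplacian_x \<phi> z
        - \<nu> * (norm (Du z))\<^sup>2 * \<phi> z)"

definition loc_finite_borel_measure :: "'a::topological_space set \<Rightarrow> 'a measure \<Rightarrow> bool" where
  "loc_finite_borel_measure X \<mu> \<longleftrightarrow> sets \<mu> = sets (restrict_space borel X) \<and>
     (\<forall>K. compact K \<and> K \<subseteq> X \<longrightarrow> emeasure \<mu> K < \<infinity>)"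

text \<open>\<open>D[u]\<close> is the nonnegative Radon measure \<open>\<mu>\<close> on \<open>\<Omega> \<times> (0,T)\<close>.\<close>

definition dissipation_measure ::
  "real \<Rightarrow> (real^'d) set \<Rightarrow> real \<Rightarrow> ((real^'d) \<times> real \<Rightarrow> real^'d) \<Rightarrow> ((real^'d) \<times> real \<Rightarrow> real^'d^'d)
    \<Rightarrow> ((real^'d) \<times> real \<Rightarrow> real) \<Rightarrow> ((real^'d) \<times> real) measure \<Rightarrow> bool" where
  "dissipation_measure \<nu> \<Omega> T u Du p \<mu> \<longleftrightarrow>
     loc_finite_borel_measure (\<Omega> \<times> {0<..<T}) \<mu> \<and>
     (\<forall>\<phi> :: (real^'d) \<times> real \<Rightarrow> real. test_function (\<Omega> \<times> {0<..<T}) \<phi> \<longrightarrow>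
        dissipation \<nu> \<Omega> T u Du p \<phi> = (LINT z|\<mu>. \<phi> z))"

definition concentrated_on :: "'a measure \<Rightarrow> 'a set \<Rightarrow> bool" where
  "concentrated_on \<mu> S \<longleftrightarrow> (\<forall>A\<in>sets \<mu>. emeasure \<mu> A = emeasure \<mu> (A \<inter> S))"

definition aniso_cylinder :: "real \<Rightarrow> real \<Rightarrow> (real^'d) \<times> real \<Rightarrow> ((real^'d) \<times> real) set" where
  "aniso_cylinder \<alpha> \<delta> z = ball (fst z) \<delta> \<times> {snd z - \<delta> powr \<alpha> <..< snd z + \<delta> powr \<alpha>}"

text \<open>Countable families are indexed by arbitrary sets \<open>I\<close> of natural numbers, so that finite and
  empty covers are allowed.\<close>

definition aniso_premeasure :: "real \<Rightarrow> real \<Rightarrow> real \<Rightarrow> ((real^'d) \<times> real) set \<Rightarrow> ennreal" where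
  "aniso_premeasure \<alpha> s \<rho> A =
     Inf {(\<Sum>\<^sub>\<infinity>i\<in>I. ennreal (r i powr s)) | (I :: nat set) (r :: nat \<Rightarrow> real) (z :: nat \<Rightarrow> (real^'d) \<times> real).
       (\<forall>i\<in>I. 0 < r i \<and> diameter (aniso_cylinder \<alpha> (r i) (z i)) \<le> \<rho>) \<and>
       A \<subseteq> (\<Union>i\<in>I. aniso_cylinder \<alpha> (r i) (z i))}"

definition aniso_hausdorff :: "real \<Rightarrow> real \<Rightarrow> ((real^'d) \<times> real) set \<Rightarrow> ennreal" where
  "aniso_hausdorff \<alpha> s A = Lim (at_right 0) (\<lambda>\<rho>. aniso_premeasure \<alpha> s \<rho> A)"

definition aniso_hausdorff_dim :: "real \<Rightarrow> ((real^'d) \<times> real) set \<Rightarrow> ereal" where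
  "aniso_hausdorff_dim \<alpha> A = Inf {ereal s | s. 0 \<le> s \<and> aniso_hausdorff \<alpha> s A = 0}"

definition critical_exponent :: "real \<Rightarrow> real \<Rightarrow> ereal \<Rightarrow> ereal \<Rightarrow> real" where
  "critical_exponent d \<alpha> r q =
     (if r < \<infinity> \<and> q < \<infinity> then
        (let r' = real_of_ereal r; q' = real_of_ereal q in
          Min {d * ((r' - 2) / r') - \<alpha> * (2 / q'),
               - 1 + d * ((r' - 3) / r') + \<alpha> * ((q' - 3) / q'),
               - 2 + d * ((r' - 2) / r') + \<alpha> * ((q' - 2) / q')})
      else if q < \<infinity> then
        (let q' = real_of_ereal q in
          Min {d - \<alpha> * (2 / q'),
               d - 1 + \<alpha> * ((q' - 3) / q'),
               d - 2 + \<alpha> * ((q' - 2) / q')})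
      else if r < \<infinity> then
        (let r' = real_of_ereal r in
          Min {d * ((r' - 2) / r'),
               - 1 + d * ((r' - 3) / r') + \<alpha>,
               - 2 + d * ((r' - 2) / r') + \<alpha>})
      else min d (d - 2 + \<alpha>))"

end

theory Submission
  imports Defs
begin

text \<open>The statement is a mass distribution principle: if a measure gives every small cylinder
  \<open>C\<close> of radius \<open>\<delta>\<close> a mass at most \<open>c \<delta>\<^sup>s\<close>, then summing over a cover
  bounds the mass of a set by \<open>c\<close> times its \<open>\<H>\<^sup>s\<^sub>\<alpha>\<close> measure. Everything therefore rests on
  a bound for the dissipation of one cylinder.

  To get it, test the local energy identity with a smooth bump that is bounded below on \<open>C\<close>
  and supported in the cylinder \<open>Q\<close> with radius and duration doubled. The term with
  \<open>\<bar>Du\<bar>\<^sup>2\<close> has a favourable sign and is dropped. A time derivative of the bump costs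
  \<open>\<delta>\<^bsup>-\<alpha>\<^esup>\<close>, a gradient \<open>\<delta>\<^bsup>-1\<^esup>\<close>, a Laplacian \<open>\<delta>\<^bsup>-2\<^esup>\<close>, and the pressure is separated
  from the velocity by \<open>\<bar>p\<bar>\<bar>u\<bar> \<le> \<bar>p\<bar>\<^bsup>3/2\<^esup> + \<bar>u\<bar>\<^sup>3\<close>. Hence the mass of \<open>C\<close> is bounded by
  \<open>(\<delta>\<^bsup>-\<alpha>\<^esup> + \<delta>\<^bsup>-2\<^esup>) \<integral>\<^sub>Q \<bar>u\<bar>\<^sup>2 + \<delta>\<^bsup>-1\<^esup> \<integral>\<^sub>Q (\<bar>u\<bar>\<^sup>3 + \<bar>p\<bar>\<^bsup>3/2\<^esup>)\<close> up to a constant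
  (\<open>dissipation_cylinder_le\<close>).

  Hoelder's inequality, first in space and then in time, bounds \<open>\<integral>\<^sub>Q \<bar>u\<bar>\<^sup>a\<close> by
  \<open>\<delta>\<^bsup>d (1 - a/r) + \<alpha> (1 - a/q)\<^esup>\<close> times the power \<open>a\<close> of the \<open>L\<^sup>q L\<^sup>r\<close> norm
  (\<open>nn_integral_pow_le_mixed_norm\<close>). The term \<open>\<bar>p\<bar>\<^bsup>3/2\<^esup>\<close> scales exactly like \<open>\<bar>u\<bar>\<^sup>3\<close>, because
  both exponents of the pressure are halved. The three resulting powers of \<open>\<delta>\<close> are the three
  entries in the minimum that defines \<open>s\<close>, which gives the bound \<open>c \<delta>\<^sup>s\<close>
  (\<open>emeasure_cylinder_le\<close>). The factor \<open>c\<close> contains norms of \<open>u\<close> and \<open>p\<close> over a time interval of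
  length comparable to \<open>\<delta>\<^sup>\<alpha>\<close>. For \<open>q = \<infinity>\<close> they are merely bounded, which yields the
  conclusion for \<open>\<H>\<^sup>s\<^sub>\<alpha>\<close>-null sets. For \<open>q < \<infinity>\<close> they tend to 0 uniformly in the position of the cylinder, by
  absolute continuity of the integral in time (\<open>mixed_norm_short_time\<close>), which yields it for
  sets of finite \<open>\<H>\<^sup>s\<^sub>\<alpha>\<close> measure (\<open>dissipation_growth\<close>).

  For the dimension, a set of dimension less than \<open>s\<close> is \<open>\<H>\<^sup>s\<^sub>\<alpha>\<close>-null. Its traces on a compact
  exhaustion of the domain are null for the dissipation, so the dissipation cannot be
  concentrated on it unless it vanishes.\<close>

section \<open>Smooth bumps adapted to anisotropic cylinders\<close>

lemma ddir_eqI: "(f has_derivative f') (at x) \<Longrightarrow> ddir v f x = f' v"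
  by (metis ddir_def frechet_derivative_at)

lemma differentiable_has_ddir: "f differentiable (at x) \<Longrightarrow> (f has_derivative (\<lambda>v. ddir v f x)) (at x)"
  unfolding ddir_def by (simp add: frechet_derivative_works)

lemma C_k_SucD: "C_k (Suc n) f \<Longrightarrow> C_k n f"
proof (induction n arbitrary: f)
  case 0
  then show ?case
    by (auto intro!: continuous_at_imp_continuous_on differentiable_imp_continuous_within)
qed simp

lemma C_k_SucI:
  assumes "\<And>x. (f has_derivative (\<lambda>v. g v x)) (at x)" "\<And>v. C_k n (g v)"
  shows "C_k (Suc n) f"
proof -
  have "ddir v f = g v" for v
    using assms(1) by (auto intro!: ext ddir_eqI)
  then show ?thesis
    using assms by (auto simp: differentiable_def)
qed

lemma C_k_const: "C_k n (\<lambda>_. c)"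
proof (induction n arbitrary: c)
  case (Suc n)
  show ?case by (rule C_k_SucI[where g="\<lambda>_ _. 0"]) (auto intro: Suc)
qed simp

lemma C_k_bounded_linear:
  assumes "bounded_linear f"
  shows "C_k n f"
proof (cases n)
  case 0
  then show ?thesis using assms by (simp add: linear_continuous_on)
next
  case (Suc m)
  show ?thesis unfolding Suc
    by (rule C_k_SucI[where g="\<lambda>v _. f v"])
       (auto intro: C_k_const bounded_linear_imp_has_derivative assms)
qed

lemma C_k_add: "C_k n f \<Longrightarrow> C_k n g \<Longrightarrow> C_k n (\<lambda>x. f x + g x)"
proof (induction n arbitrary: f g)
  case (Suc n)
  show ?case
    by (rule C_k_SucI[where g="\<lambda>v x. ddir v f x + ddir v g x"])
       (use Suc in \<open>auto intro!: derivative_intros differentiable_has_ddir\<close>)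
qed (auto intro: continuous_intros)

lemma C_k_mult:
  fixes f g :: "'a::real_normed_vector \<Rightarrow> real"
  shows "C_k n f \<Longrightarrow> C_k n g \<Longrightarrow> C_k n (\<lambda>x. f x * g x)"
proof (induction n arbitrary: f g)
  case (Suc n)
  show ?case
  proof (rule C_k_SucI[where g="\<lambda>v x. f x * ddir v g x + ddir v f x * g x"])
    fix x show "((\<lambda>x. f x * g x) has_derivative (\<lambda>v. f x * ddir v g x + ddir v f x * g x)) (at x)"
      using Suc.prems by (auto intro!: has_derivative_mult differentiable_has_ddir)
  next
    fix v show "C_k n (\<lambda>x. f x * ddir v g x + ddir v f x * g x)"
      using Suc.prems C_k_SucD[OF Suc.prems(1)] C_k_SucD[OF Suc.prems(2)]
      by (auto intro!: C_k_add Suc.IH)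
  qed
qed (auto intro: continuous_intros)

lemma C_k_comp_affine:
  assumes L: "bounded_linear L"
  shows "C_k n f \<Longrightarrow> C_k n (\<lambda>z. f (L z + b))"
proof (induction n arbitrary: f)
  case 0
  have "continuous_on UNIV (\<lambda>z. L z + b)"
    by (intro continuous_intros linear_continuous_on L)
  then show ?case using 0 by (auto intro: continuous_on_compose2)
next
  case (Suc n)
  have L': "((\<lambda>z. L z + b) has_derivative L) (at x)" for x
    using has_derivative_add[OF bounded_linear_imp_has_derivative[OF L] has_derivative_const[of b]] by simp
  show ?case
    by (rule C_k_SucI[where g="\<lambda>v z. ddir (L v) f (L z + b)"])
       (use Suc in \<open>auto intro!: has_derivative_compose[OF L'] differentiable_has_ddir\<close>)
qed

lemma smooth_comp_affine:
  "bounded_linear L \<Longrightarrow> smooth f \<Longrightarrow> smooth (\<lambda>z. f (L z + b))"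
  by (simp add: smooth_def C_k_comp_affine)

lemma ddir_comp_affine:
  assumes L: "bounded_linear L" and f: "f differentiable at (L z + b)"
  shows "ddir v (\<lambda>z. f (L z + b)) z = ddir (L v) f (L z + b)"
proof -
  have L': "((\<lambda>z. L z + b) has_derivative L) (at z)"
    using has_derivative_add[OF bounded_linear_imp_has_derivative[OF L] has_derivative_const[of b]] by simp
  show ?thesis
    by (rule ddir_eqI) (rule has_derivative_compose[OF L' differentiable_has_ddir[OF f]])
qed

text \<open>For each \<open>m\<close> the function \<open>s\<^bsup>-m\<^esup> exp (- 1/s)\<close>, extended by 0 to \<open>s \<le> 0\<close>, is smooth. The
  powers \<open>m\<close> are included because the linear span of these functions is closed under
  differentiation, so that smoothness follows by induction without a formula for higher derivatives.\<close>

definition flat :: "nat \<Rightarrow> real \<Rightarrow> real" where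
  "flat m s = (if s > 0 then inverse s ^ m * exp (- inverse s) else 0)"

lemma flat_has_field_derivative:
  "(flat m has_field_derivative (flat (m + 2) s - real m * flat (m + 1) s)) (at s)"
proof -
  \<comment> \<open>Away from the origin the product rule suffices. At the origin, from the right, the difference quotient is
    \<open>x\<^bsup>m+1\<^esup> / exp x\<close> at \<open>x = 1/s\<close>.\<close>
  consider "s < 0" | "s = 0" | "s > 0" by linarith
  then show ?thesis
  proof cases
    case 1
    then have "((\<lambda>_. 0) has_field_derivative 0) (at s)" by simp
    then have "(flat m has_field_derivative 0) (at s)"
      by (rule has_field_derivative_transform_within_open[where S="{..<0}"])
         (use 1 in \<open>auto simp: flat_def\<close>)
    then show ?thesis using 1 by (simp add: flat_def)
  next
    case 2
    have "((\<lambda>h. inverse h ^ Suc m / exp (inverse h)) \<longlongrightarrow> (0::real)) (at_right 0)"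
      by (rule filterlim_compose[OF tendsto_power_div_exp_0 filterlim_inverse_at_top_right])
    moreover have "eventually (\<lambda>h. inverse h ^ Suc m / exp (inverse h) = flat m h / h) (at_right 0)"
      by (auto simp: eventually_at_filter flat_def exp_minus field_simps)
    ultimately have r: "((\<lambda>h. flat m h / h) \<longlongrightarrow> 0) (at_right 0)"
      by (rule Lim_transform_eventually)
    have "eventually (\<lambda>h. 0 = flat m h / h) (at_left 0)"
      by (auto simp: eventually_at_filter flat_def)
    then have l: "((\<lambda>h. flat m h / h) \<longlongrightarrow> 0) (at_left 0)"
      by (rule Lim_transform_eventually[OF tendsto_const])
    have "((\<lambda>h. flat m h / h) \<longlongrightarrow> 0) (at 0)"
      using l r by (simp add: filterlim_at_split)
    then show ?thesis using 2 by (simp add: DERIV_def flat_def)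
  next
    case 3
    have "((\<lambda>s. inverse s ^ m * exp (- inverse s)) has_field_derivative
        (inverse s ^ (m + 2) * exp (- inverse s) - real m * (inverse s ^ (m + 1) * exp (- inverse s)))) (at s)"
    proof -
      have "((\<lambda>s. inverse s ^ m) has_field_derivative (- real m * inverse s ^ (m + 1))) (at s)"
      proof (cases m)
        case (Suc n)
        then show ?thesis
          using DERIV_power_Suc[OF DERIV_inverse[of s], of n] 3 by (simp add: algebra_simps)
      qed simp
      moreover have "((\<lambda>s. exp (- inverse s)) has_field_derivative (exp (- inverse s) * inverse s ^ 2)) (at s)"
        using 3 by (auto intro!: derivative_eq_intros simp: power2_eq_square)
      ultimately show ?thesis
        by (rule DERIV_cong[OF DERIV_mult]) (simp add: algebra_simps power2_eq_square)
    qed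
    then have "(flat m has_field_derivative
        (inverse s ^ (m + 2) * exp (- inverse s) - real m * (inverse s ^ (m + 1) * exp (- inverse s)))) (at s)"
      by (rule has_field_derivative_transform_within_open[where S="{0<..}"])
         (use 3 in \<open>auto simp: flat_def\<close>)
    then show ?thesis using 3 by (simp add: flat_def)
  qed
qed

text \<open>The induction on the order must range over all \<open>m\<close>, as the derivative of \<open>flat m\<close> involves
  \<open>flat (m + 1)\<close> and \<open>flat (m + 2)\<close>.\<close>

lemma C_k_flat_comp:
  fixes f :: "'a::real_normed_vector \<Rightarrow> real"
  shows "C_k n f \<Longrightarrow> C_k n (\<lambda>x. flat m (f x))"
proof (induction n arbitrary: m)
  case 0
  have "continuous_on UNIV (flat m)"
    by (intro continuous_at_imp_continuous_on ballI DERIV_isCont[OF flat_has_field_derivative])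
  then show ?case using 0 by (auto intro: continuous_on_compose2)
next
  case (Suc n)
  show ?case
  proof (rule C_k_SucI[where g="\<lambda>v x. (flat (m + 2) (f x) + (- real m) * flat (m + 1) (f x)) * ddir v f x"])
    fix x
    show "((\<lambda>x. flat m (f x)) has_derivative
        (\<lambda>v. (flat (m + 2) (f x) + (- real m) * flat (m + 1) (f x)) * ddir v f x)) (at x)"
      using has_derivative_compose[OF differentiable_has_ddir
          flat_has_field_derivative[unfolded has_field_derivative_def], of f x m] Suc.prems
      by (simp add: algebra_simps)
  next
    fix v
    show "C_k n (\<lambda>x. (flat (m + 2) (f x) + (- real m) * flat (m + 1) (f x)) * ddir v f x)"
      using Suc.prems C_k_SucD[OF Suc.prems]
      by (intro C_k_mult C_k_add C_k_const Suc.IH) auto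
  qed
qed

text \<open>A product of a spatial and a temporal factor, so that its support is a cylinder rather than
  a ball. A positive lower bound on the unit cylinder takes the place of a plateau.\<close>

definition bump :: "(real^'d) \<times> real \<Rightarrow> real" where
  "bump z = flat 0 (4 - fst z \<bullet> fst z) * flat 0 (4 - snd z * snd z)"

lemma smooth_bump: "smooth bump"
  unfolding smooth_def
proof
  fix n
  have inner: "C_k n (\<lambda>z::(real^'d) \<times> real. fst z \<bullet> fst z)"
  proof (cases n)
    case 0
    then show ?thesis by (auto intro!: continuous_intros)
  next
    case (Suc m)
    show ?thesis unfolding Suc
    proof (rule C_k_SucI[where g="\<lambda>v z. 2 * (fst v \<bullet> fst z)"])
      fix v :: "(real^'d) \<times> real"
      show "C_k m (\<lambda>z. 2 * (fst v \<bullet> fst z))"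
        by (intro C_k_bounded_linear bounded_linear_intros)
    qed (auto intro!: derivative_eq_intros simp: inner_commute)
  qed
  have snd: "C_k n (\<lambda>z::(real^'d) \<times> real. snd z * snd z)"
    by (intro C_k_mult C_k_bounded_linear bounded_linear_snd)
  have minus: "C_k n (\<lambda>z. 4 - f z)" if "C_k n f" for f :: "(real^'d) \<times> real \<Rightarrow> real"
    using C_k_add[OF C_k_const[of n 4] C_k_mult[OF C_k_const[of n "-1"] that]] by simp
  show "C_k n (bump :: (real^'d) \<times> real \<Rightarrow> real)"
    unfolding bump_def[abs_def] by (intro C_k_mult C_k_flat_comp minus inner snd)
qed

lemma bump_nonneg: "bump z \<ge> 0"
  by (simp add: bump_def flat_def)

lemma bump_zero_outside: "z \<notin> cball 0 2 \<times> cball 0 2 \<Longrightarrow> bump z = 0"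
proof -
  assume "z \<notin> cball 0 2 \<times> cball 0 2"
  then consider "norm (fst z) > 2" | "\<bar>snd z\<bar> > 2" by (cases z) auto
  then show ?thesis
  proof cases
    case 1
    then have "norm (fst z) ^ 2 > 2 ^ 2" by (intro power_strict_mono) auto
    then show ?thesis by (simp add: bump_def flat_def dot_square_norm)
  next
    case 2
    then have "\<bar>snd z\<bar> ^ 2 > 2 ^ 2" by (intro power_strict_mono) auto
    then show ?thesis by (simp add: bump_def flat_def power2_eq_square)
  qed
qed

lemma bump_ge:
  assumes "norm (fst z) < 1" "\<bar>snd z\<bar> < 1" shows "bump z \<ge> exp (- 2 / 3)"
proof -
  have flat: "flat 0 (4 - s) \<ge> exp (- 1 / 3)" if "s < 1" for s
    using that by (auto simp: flat_def field_simps)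
  have "norm (fst z) ^ 2 < 1 ^ 2" "\<bar>snd z\<bar> ^ 2 < 1 ^ 2"
    using assms by (intro power_strict_mono; simp)+
  then have "fst z \<bullet> fst z < 1" "snd z * snd z < 1"
    by (simp_all add: dot_square_norm power2_eq_square)
  then have "flat 0 (4 - fst z \<bullet> fst z) \<ge> exp (- 1 / 3)" "flat 0 (4 - snd z * snd z) \<ge> exp (- 1 / 3)"
    by (blast intro: flat)+
  then have "exp (- 1 / 3) * exp (- 1 / 3 :: real) \<le> bump z"
    unfolding bump_def by (intro mult_mono) (auto intro: order_trans[rotated])
  then show ?thesis by (simp flip: exp_add)
qed

text \<open>The complement of \<open>Q\<close> is open, so \<open>f\<close> vanishes near each of its points. This confines the
  derivatives of a bump to the same cylinder as the bump itself.\<close>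

lemma ddir_zero_outside:
  assumes "closed Q" "\<And>z. z \<notin> Q \<Longrightarrow> f z = 0" "z \<notin> Q"
  shows "ddir v f z = 0"
proof -
  have "((\<lambda>_. 0) has_derivative (\<lambda>_. 0)) (at z)" by simp
  then have "(f has_derivative (\<lambda>_. 0)) (at z)"
    by (rule has_derivative_transform_within_open[where s="- Q"]) (use assms in auto)
  then show ?thesis by (rule ddir_eqI)
qed

lemma smooth_ddir: "smooth f \<Longrightarrow> smooth (ddir v f)"
  unfolding smooth_def by (metis C_k.simps(2))

lemma smooth_differentiable: "smooth f \<Longrightarrow> f differentiable (at x)"
  unfolding smooth_def by (metis C_k.simps(2))

lemma smooth_continuous: "smooth f \<Longrightarrow> continuous_on UNIV f"
  unfolding smooth_def by (metis C_k.simps(1))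

lemma ddir_scale:
  assumes "f differentiable (at x)"
  shows "ddir (c *\<^sub>R v) f x = c *\<^sub>R ddir v f x"
  using has_derivative_bounded_linear[OF differentiable_has_ddir[OF assms]]
  by (simp add: bounded_linear.linear linear_scale[where f="\<lambda>v. ddir v f x"])

lemma smooth_bounded_of_compact_support:
  fixes g :: "'a::real_normed_vector \<Rightarrow> real"
  assumes "smooth g" "compact Q" "\<And>z. z \<notin> Q \<Longrightarrow> g z = 0"
  shows "\<exists>M\<ge>0. \<forall>z. \<bar>g z\<bar> \<le> M"
proof -
  have "compact (g ` Q)"
    using assms by (intro compact_continuous_image continuous_on_subset[OF smooth_continuous]) auto
  then obtain M where M: "\<And>z. z \<in> Q \<Longrightarrow> \<bar>g z\<bar> \<le> M"
    using compact_imp_bounded[of "g ` Q"] by (auto simp: bounded_iff)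
  have "\<bar>g z\<bar> \<le> max M 0" for z
    using M[of z] assms(3)[of z] by (cases "z \<in> Q") auto
  then show ?thesis by (intro exI[of _ "max M 0"]) auto
qed

definition double_cylinder :: "real \<Rightarrow> real \<Rightarrow> (real^'d) \<times> real \<Rightarrow> ((real^'d) \<times> real) set" where
  "double_cylinder \<alpha> \<delta> z = cball (fst z) (2 * \<delta>) \<times> cball (snd z) (2 * \<delta> powr \<alpha>)"

text \<open>Rescaling one fixed bump by \<open>\<delta>\<close> in space and \<open>\<delta>\<^sup>\<alpha>\<close> in time yields a test function for every
  cylinder, with a constant \<open>M\<close> that depends on neither the radius nor the centre: each derivative
  produces one power of the scaling factor, and the derivatives of the fixed bump are bounded
  because they are continuous with compact support.\<close>

lemma adapted_bump:
  fixes \<alpha> :: real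
  shows "\<exists>M\<ge>0. \<forall>\<delta>>0. \<forall>z. \<exists>\<phi> :: (real^'d) \<times> real \<Rightarrow> real.
    smooth \<phi> \<and> (\<forall>w. 0 \<le> \<phi> w) \<and> (\<forall>w\<in>aniso_cylinder \<alpha> \<delta> z. exp (- 2 / 3) \<le> \<phi> w) \<and>
    (\<forall>w. w \<notin> double_cylinder \<alpha> \<delta> z \<longrightarrow> \<phi> w = 0) \<and>
    (\<forall>w. \<bar>dt \<phi> w\<bar> \<le> M * \<delta> powr (- \<alpha>) * indicator (double_cylinder \<alpha> \<delta> z) w) \<and>
    (\<forall>w. norm (grad_x \<phi> w) \<le> M * \<delta> powr (- 1) * indicator (double_cylinder \<alpha> \<delta> z) w) \<and>
    (\<forall>w. \<bar>laplacian_x \<phi> w\<bar> \<le> M * \<delta> powr (- 2) * indicator (double_cylinder \<alpha> \<delta> z) w)"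
proof -
  let ?Q = "cball 0 2 \<times> cball 0 2 :: ((real^'d) \<times> real) set"
  let ?b = "bump :: (real^'d) \<times> real \<Rightarrow> real"
  let ?e = "\<lambda>i::'d. (axis i 1, 0) :: (real^'d) \<times> real"
  have Q: "compact ?Q" "closed ?Q" by (auto intro: compact_Times closed_Times)
  have z1: "ddir v ?b w = 0" if "w \<notin> ?Q" for v w
    by (rule ddir_zero_outside[OF Q(2) _ that]) (rule bump_zero_outside)
  have z2: "ddir v' (ddir v ?b) w = 0" if "w \<notin> ?Q" for v v' w
    by (rule ddir_zero_outside[OF Q(2) _ that]) (rule z1)
  have "\<forall>v. \<exists>M\<ge>0. \<forall>w. \<bar>ddir v ?b w\<bar> \<le> M"
    by (intro allI smooth_bounded_of_compact_support[OF _ Q(1)] smooth_ddir smooth_bump z1)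
  then obtain M1 where M1: "\<And>v. M1 v \<ge> 0" "\<And>v w. \<bar>ddir v ?b w\<bar> \<le> M1 v" by metis
  have "\<forall>v. \<exists>M\<ge>0. \<forall>w. \<bar>ddir v (ddir v ?b) w\<bar> \<le> M"
    by (intro allI smooth_bounded_of_compact_support[OF _ Q(1)] smooth_ddir smooth_bump z2)
  then obtain M2 where M2: "\<And>v. M2 v \<ge> 0" "\<And>v w. \<bar>ddir v (ddir v ?b) w\<bar> \<le> M2 v" by metis
  define M where "M = M1 (0, 1) + (\<Sum>i\<in>UNIV. M1 (?e i)) + (\<Sum>i\<in>UNIV. M2 (?e i))"
  have "M \<ge> 0" using M1 M2 by (auto simp: M_def intro!: add_nonneg_nonneg sum_nonneg)
  have Mt: "M1 (0, 1) \<le> M" and Mg: "(\<Sum>i\<in>UNIV. M1 (?e i)) \<le> M" and Ml: "(\<Sum>i\<in>UNIV. M2 (?e i)) \<le> M"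
    using M1(1) M2(1) by (auto simp: M_def intro!: sum_nonneg add_nonneg_nonneg)
  show ?thesis
  proof (intro exI[of _ M] conjI allI impI \<open>M \<ge> 0\<close>, goal_cases)
    case (1 \<delta> z)
    define L :: "(real^'d) \<times> real \<Rightarrow> (real^'d) \<times> real"
      where "L = (\<lambda>w. (inverse \<delta> *\<^sub>R fst w, \<delta> powr (- \<alpha>) * snd w))"
    define b where "b = - L z"
    define \<phi> where "\<phi> = (\<lambda>w. ?b (L w + b))"
    have p: "\<delta> powr \<alpha> > 0" using 1 by simp
    have L: "bounded_linear L" unfolding L_def by (intro bounded_linear_intros)
    have A: "L w + b = (inverse \<delta> *\<^sub>R (fst w - fst z), \<delta> powr (- \<alpha>) * (snd w - snd z))" for w
      by (simp add: b_def L_def algebra_simps)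
    have Anorm: "norm (fst (L w + b)) = norm (fst w - fst z) / \<delta>"
      "\<bar>snd (L w + b)\<bar> = \<bar>snd w - snd z\<bar> / \<delta> powr \<alpha>" for w
    proof -
      have "norm (inverse \<delta> *\<^sub>R v) = norm v / \<delta>" for v :: "real^'d"
        using 1 by (simp add: divide_inverse_commute)
      moreover have "\<bar>\<delta> powr (- \<alpha>) * y\<bar> = \<bar>y\<bar> / \<delta> powr \<alpha>" for y
        by (simp add: abs_mult powr_minus_divide)
      ultimately show "norm (fst (L w + b)) = norm (fst w - fst z) / \<delta>"
          "\<bar>snd (L w + b)\<bar> = \<bar>snd w - snd z\<bar> / \<delta> powr \<alpha>"
        unfolding A fst_conv snd_conv by blast+
    qed
    have Le: "L (?e i) = inverse \<delta> *\<^sub>R ?e i" for i by (simp add: L_def)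
    have Lt: "L (0, 1) = \<delta> powr (- \<alpha>) *\<^sub>R (0, 1)" by (simp add: L_def)
    have out: "L w + b \<notin> ?Q" if "w \<notin> double_cylinder \<alpha> \<delta> z" for w
    proof -
      have "2 * \<delta> < dist (fst z) (fst w) \<or> 2 * \<delta> powr \<alpha> < dist (snd z) (snd w)"
        using that by (cases w) (auto simp: double_cylinder_def)
      then have "2 < norm (fst (L w + b)) \<or> 2 < \<bar>snd (L w + b)\<bar>"
        unfolding Anorm using 1 p
        by (auto simp only: pos_less_divide_eq dist_norm norm_minus_commute real_norm_def)
      then show ?thesis by (auto simp: mem_Times_iff)
    qed
    have d1: "ddir v \<phi> w = ddir (L v) ?b (L w + b)" for v w
      unfolding \<phi>_def by (rule ddir_comp_affine[OF L smooth_differentiable[OF smooth_bump]])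
    have dti: "dt \<phi> w = \<delta> powr (- \<alpha>) * ddir (0, 1) ?b (L w + b)" for w
      by (simp only: dt_def d1 Lt ddir_scale[OF smooth_differentiable[OF smooth_bump]] real_scaleR_def)
    have dxi: "dx i \<phi> w = \<delta> powr (- 1) * ddir (?e i) ?b (L w + b)" for i w
      using 1 by (simp only: dx_def d1 Le ddir_scale[OF smooth_differentiable[OF smooth_bump]] real_scaleR_def)
        (simp add: powr_minus powr_one)
    have dxx: "dx i (dx i \<phi>) w = \<delta> powr (- 2) * ddir (?e i) (ddir (?e i) ?b) (L w + b)" for i w
    proof -
      have "dx i \<phi> = (\<lambda>w. inverse \<delta> * ddir (?e i) ?b (L w + b))"
        using 1 by (auto simp: dxi powr_minus powr_one)
      have "dx i (dx i \<phi>) w = inverse \<delta> * ddir (L (?e i)) (ddir (?e i) ?b) (L w + b)"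
        unfolding \<open>dx i \<phi> = _\<close> unfolding dx_def
        using ddir_eqI[OF has_derivative_mult_right[OF differentiable_has_ddir[OF
              smooth_differentiable[OF smooth_comp_affine[OF L smooth_ddir[OF smooth_bump]]]]]]
        by (simp add: ddir_comp_affine[OF L smooth_differentiable[OF smooth_ddir[OF smooth_bump]]])
      also have "\<dots> = inverse \<delta> * (inverse \<delta> * ddir (?e i) (ddir (?e i) ?b) (L w + b))"
        by (simp only: Le ddir_scale[OF smooth_differentiable[OF smooth_ddir[OF smooth_bump]]] real_scaleR_def)
      also have "\<dots> = \<delta> powr (- 2) * ddir (?e i) (ddir (?e i) ?b) (L w + b)"
        using 1 by (simp add: powr_minus power2_eq_square)
      finally show ?thesis .
    qed
    show ?case
    proof (intro exI[of _ \<phi>] conjI allI ballI impI)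
      show "smooth \<phi>"
        unfolding \<phi>_def by (rule smooth_comp_affine[OF L smooth_bump])
      show "0 \<le> \<phi> w" for w by (simp add: \<phi>_def bump_nonneg)
      show "exp (- 2 / 3) \<le> \<phi> w" if "w \<in> aniso_cylinder \<alpha> \<delta> z" for w
      proof -
        have "dist (fst z) (fst w) < \<delta>" "\<bar>snd w - snd z\<bar> < \<delta> powr \<alpha>"
          using that by (auto simp: aniso_cylinder_def)
        then have "norm (fst (L w + b)) < 1" "\<bar>snd (L w + b)\<bar> < 1"
          unfolding Anorm using 1 p by (simp_all add: dist_norm norm_minus_commute)
        then show ?thesis unfolding \<phi>_def by (rule bump_ge)
      qed
      show "\<phi> w = 0" if "w \<notin> double_cylinder \<alpha> \<delta> z" for w
        unfolding \<phi>_def by (rule bump_zero_outside[OF out[OF that]])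
      show "\<bar>dt \<phi> w\<bar> \<le> M * \<delta> powr (- \<alpha>) * indicator (double_cylinder \<alpha> \<delta> z) w" for w
        using z1[OF out, of w "(0,1)"] order_trans[OF M1(2)[of "(0,1)" "L w + b"] Mt]
        by (cases "w \<in> double_cylinder \<alpha> \<delta> z")
           (auto simp: dti abs_mult mult.commute[of M] intro!: mult_left_mono)
      show "norm (grad_x \<phi> w) \<le> M * \<delta> powr (- 1) * indicator (double_cylinder \<alpha> \<delta> z) w" for w
      proof -
        have "norm (grad_x \<phi> w) \<le> (\<Sum>i\<in>UNIV. \<bar>grad_x \<phi> w $ i\<bar>)" by (rule norm_le_l1_cart)
        also have "\<dots> = \<delta> powr (- 1) * (\<Sum>i\<in>UNIV. \<bar>ddir (?e i) ?b (L w + b)\<bar>)"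
          by (simp add: grad_x_def dxi abs_mult sum_distrib_left)
        also have "\<dots> \<le> M * \<delta> powr (- 1) * indicator (double_cylinder \<alpha> \<delta> z) w"
        proof (cases "w \<in> double_cylinder \<alpha> \<delta> z")
          case True
          have "(\<Sum>i\<in>UNIV. \<bar>ddir (?e i) ?b (L w + b)\<bar>) \<le> (\<Sum>i\<in>UNIV. M1 (?e i))"
            by (intro sum_mono M1(2))
          then show ?thesis using True Mg
            by (auto simp: mult.commute[of M] intro!: mult_left_mono divide_right_mono)
        qed (use z1[OF out] in auto)
        finally show ?thesis .
      qed
      show "\<bar>laplacian_x \<phi> w\<bar> \<le> M * \<delta> powr (- 2) * indicator (double_cylinder \<alpha> \<delta> z) w" for w
      proof -
        have "\<bar>laplacian_x \<phi> w\<bar> \<le> (\<Sum>i\<in>UNIV. \<bar>dx i (dx i \<phi>) w\<bar>)"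
          unfolding laplacian_x_def by (rule sum_abs)
        also have "\<dots> = \<delta> powr (- 2) * (\<Sum>i\<in>UNIV. \<bar>ddir (?e i) (ddir (?e i) ?b) (L w + b)\<bar>)"
          by (simp add: dxx abs_mult sum_distrib_left)
        also have "\<dots> \<le> M * \<delta> powr (- 2) * indicator (double_cylinder \<alpha> \<delta> z) w"
        proof (cases "w \<in> double_cylinder \<alpha> \<delta> z")
          case True
          have "(\<Sum>i\<in>UNIV. \<bar>ddir (?e i) (ddir (?e i) ?b) (L w + b)\<bar>) \<le> (\<Sum>i\<in>UNIV. M2 (?e i))"
            by (intro sum_mono M2(2))
          then show ?thesis using True Ml
            by (auto simp: mult.commute[of M] intro!: mult_left_mono divide_right_mono)
        qed (use z2[OF out] in auto)
        finally show ?thesis .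
      qed
    qed
  qed
qed

section \<open>Hoelder's inequality and absolute continuity in mixed norms\<close>

lemma ennreal_pow_ennreal: "0 \<le> y \<Longrightarrow> ennreal_pow (ennreal y) a = ennreal (y powr a)"
  by (simp add: ennreal_pow_def)

lemma ennreal_pow_top: "ennreal_pow top a = top"
  by (simp add: ennreal_pow_def)

lemma ennreal_pow_mono: "x \<le> y \<Longrightarrow> 0 \<le> a \<Longrightarrow> ennreal_pow x a \<le> ennreal_pow y a"
  by (cases x; cases y) (auto simp: ennreal_pow_ennreal ennreal_pow_top powr_mono2 top_unique)

lemma ennreal_pow_pow: "ennreal_pow (ennreal_pow x a) b = ennreal_pow x (a * b)"
  by (cases x) (auto simp: ennreal_pow_ennreal ennreal_pow_top powr_powr)

lemma ennreal_pow_eq_top_iff: "ennreal_pow x a = top \<longleftrightarrow> x = top"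
  by (cases x) (auto simp: ennreal_pow_ennreal ennreal_pow_top)

lemma ennreal_pow_eq_0_iff: "ennreal_pow x a = 0 \<longleftrightarrow> x = 0"
  by (cases x) (auto simp: ennreal_pow_ennreal ennreal_pow_top)

lemma measurable_ennreal_pow [measurable]: "(\<lambda>x. ennreal_pow x a) \<in> borel \<rightarrow>\<^sub>M borel"
  unfolding ennreal_pow_def by measurable

text \<open>The concave function \<open>v \<mapsto> v\<^bsup>a/p\<^esup>\<close> lies below its tangent at \<open>A\<close>; here \<open>v = y\<^sup>p\<close>. With \<open>A\<close> the
  mean of \<open>f\<^sup>p\<close>, integration of this pointwise bound gives Hoelder's inequality against the constant 1.\<close>

lemma powr_le_tangent:
  fixes y A a p :: real
  assumes "0 \<le> y" "0 < A" "0 < a" "a \<le> p"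
  shows "y powr a \<le> A powr (a / p) * (a / p / A * y powr p + (1 - a / p))"
proof (cases "y = 0")
  case True
  then show ?thesis using assms by (auto intro!: mult_nonneg_nonneg simp: field_simps)
next
  case False
  have "(y powr p / A) powr (a / p) * 1 powr (1 - a / p) \<le> a / p * (y powr p / A) + (1 - a / p) * 1"
    using assms False by (intro Youngs_inequality_0) (auto simp: field_simps)
  then have "A powr (a / p) * (y powr p / A) powr (a / p) \<le> A powr (a / p) * (a / p * (y powr p / A) + (1 - a / p))"
    by (intro mult_left_mono) auto
  moreover have "A powr (a / p) * (y powr p / A) powr (a / p) = y powr a"
    using assms False by (simp add: powr_divide powr_powr)
  ultimately show ?thesis by (simp add: field_simps)
qed

text \<open>Hoelder's inequality for \<open>f\<^sup>a \<cdot> 1\<close> on a set of finite measure.\<close>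

lemma nn_integral_pow_le:
  assumes f[measurable]: "f \<in> borel_measurable M" and B[measurable]: "B \<in> sets M"
    and m: "emeasure M B = ennreal m" "0 < m" and a: "0 < a" "a \<le> p"
  shows "(\<integral>\<^sup>+x\<in>B. ennreal_pow (f x) a \<partial>M) \<le>
    ennreal (m powr (1 - a / p)) * ennreal_pow (\<integral>\<^sup>+x\<in>B. ennreal_pow (f x) p \<partial>M) (a / p)"
    (is "?L \<le> _ * ennreal_pow ?I _")
proof (cases ?I)
  case top
  have "m powr (1 - a / p) > 0" using m by simp
  then show ?thesis unfolding top by (simp add: ennreal_pow_top ennreal_mult_top)
next
  case (real i)
  show ?thesis
  proof (cases "i = 0")
    case True
    then have "?I = 0" using real by simp
    then have "AE x in M. ennreal_pow (f x) p * indicator B x = 0"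
      by (subst (asm) nn_integral_0_iff_AE) auto
    then have "AE x in M. ennreal_pow (f x) a * indicator B x = 0"
      by eventually_elim (auto simp: ennreal_pow_eq_0_iff)
    then have "?L = 0"
      by (subst nn_integral_0_iff_AE) auto
    then show ?thesis by simp
  next
    case False
    then have i: "i > 0" using real by simp
    \<comment> \<open>The mean of the \<open>p\<close>-th power over \<open>B\<close>, for which the tangent bound integrates to an optimal estimate.\<close>
    define A where "A = i / m"
    define \<theta> where "\<theta> = a / p"
    have A: "A > 0" using i m by (simp add: A_def)
    have \<theta>: "0 < \<theta>" "\<theta> \<le> 1" using a by (auto simp: \<theta>_def)
    have pt: "ennreal_pow y a \<le> ennreal (A powr \<theta>) * (ennreal (\<theta> / A) * ennreal_pow y p + ennreal (1 - \<theta>))" for y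
    proof (cases y)
      case (real v)
      then show ?thesis
        using powr_le_tangent[of v A a p] a A \<theta>
        by (simp add: ennreal_pow_ennreal \<theta>_def flip: ennreal_mult ennreal_plus)
    next
      case top
      then show ?thesis using A \<theta> by (simp add: ennreal_pow_top ennreal_mult_top)
    qed
    have "?L \<le> (\<integral>\<^sup>+x. ennreal (A powr \<theta>) * (ennreal (\<theta> / A) * (ennreal_pow (f x) p * indicator B x)
        + ennreal (1 - \<theta>) * indicator B x) \<partial>M)"
      using pt by (intro nn_integral_mono) (auto split: split_indicator)
    also have "\<dots> = ennreal (A powr \<theta>) * (ennreal (\<theta> / A) * ?I + ennreal (1 - \<theta>) * emeasure M B)"
      by (simp add: nn_integral_cmult nn_integral_add)
    also have "\<dots> = ennreal (A powr \<theta> * (\<theta> / A * i + (1 - \<theta>) * m))"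
      unfolding real m(1) using A i m \<theta> by (simp flip: ennreal_mult ennreal_plus)
    also have "A powr \<theta> * (\<theta> / A * i + (1 - \<theta>) * m) = m powr (1 - \<theta>) * i powr \<theta>"
    proof -
      have "\<theta> / A * i + (1 - \<theta>) * m = m" using i m by (simp add: A_def field_simps)
      then show ?thesis
        using i m by (simp add: A_def powr_divide powr_diff)
    qed
    also have "ennreal \<dots> = ennreal (m powr (1 - \<theta>)) * ennreal_pow ?I \<theta>"
      unfolding real using i by (simp add: ennreal_pow_ennreal ennreal_mult)
    finally show ?thesis by (simp add: \<theta>_def)
  qed
qed

lemma Lp_norm_cong:
  assumes "\<And>x. x \<in> space M \<Longrightarrow> f x = g x"
  shows "Lp_norm M p f = Lp_norm M p g"
proof -
  have "esssup M f = esssup M g"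
    using assms by (auto simp: esssup_def cong: measurable_cong intro!: Limsup_eq)
  moreover have "(\<integral>\<^sup>+x. ennreal_pow (f x) c \<partial>M) = (\<integral>\<^sup>+x. ennreal_pow (g x) c \<partial>M)" for c
    using assms by (intro nn_integral_cong) simp
  ultimately show ?thesis by (simp add: Lp_norm_def)
qed

text \<open>Writing the exponent with \<open>inverse p\<close> covers \<open>p = \<infinity>\<close> as well, where \<open>inverse p = 0\<close>.\<close>

lemma nn_integral_pow_le_Lp_norm:
  assumes f[measurable]: "f \<in> borel_measurable M" and B[measurable]: "B \<in> sets M"
    and m: "emeasure M B = ennreal m" "0 < m" and a: "0 < a" "ereal a \<le> p"
  shows "(\<integral>\<^sup>+x\<in>B. ennreal_pow (f x) a \<partial>M) \<le>
    ennreal (m powr (1 - a * real_of_ereal (inverse p))) * ennreal_pow (Lp_norm M p f) a"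
proof (cases p)
  case PInf
  have "AE x in M. f x \<le> Lp_norm M p f"
    using esssup_AE[of f M] by (simp add: Lp_norm_def PInf)
  then have "(\<integral>\<^sup>+x\<in>B. ennreal_pow (f x) a \<partial>M) \<le> (\<integral>\<^sup>+x. ennreal_pow (Lp_norm M p f) a * indicator B x \<partial>M)"
    by (intro nn_integral_mono_AE, eventually_elim)
       (use a in \<open>auto split: split_indicator intro: ennreal_pow_mono\<close>)
  also have "\<dots> = ennreal_pow (Lp_norm M p f) a * emeasure M B"
    by (rule nn_integral_cmult_indicator[OF B])
  also have "\<dots> = ennreal (m powr (1 - a * real_of_ereal (inverse p))) * ennreal_pow (Lp_norm M p f) a"
    using m by (simp add: PInf mult.commute)
  finally show ?thesis .
next
  case (real P)
  with a have P: "P > 0" by simp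
  have "(\<integral>\<^sup>+x\<in>B. ennreal_pow (f x) a \<partial>M) \<le>
    ennreal (m powr (1 - a / P)) * ennreal_pow (\<integral>\<^sup>+x\<in>B. ennreal_pow (f x) P \<partial>M) (a / P)"
    using a real by (intro nn_integral_pow_le m) auto
  also have "\<dots> \<le> ennreal (m powr (1 - a / P)) * ennreal_pow (\<integral>\<^sup>+x. ennreal_pow (f x) P \<partial>M) (a / P)"
    using a P by (intro mult_left_mono ennreal_pow_mono nn_integral_mono) (auto split: split_indicator)
  also have "\<dots> = ennreal (m powr (1 - a * real_of_ereal (inverse p))) * ennreal_pow (Lp_norm M p f) a"
    using P by (simp add: Lp_norm_def real ennreal_pow_pow divide_inverse mult.commute)
  finally show ?thesis .
qed (use a in auto)

text \<open>For finite \<open>p\<close> this is Tonelli's theorem. For \<open>p = \<infinity>\<close>, the essential supremum exceeds \<open>c\<close> exactly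
  if the set where \<open>g t > c\<close> has positive measure, and that measure depends measurably on \<open>t\<close>.\<close>

lemma borel_measurable_Lp_norm:
  assumes M: "sigma_finite_measure M" and g[measurable]: "(\<lambda>(t, x). g t x) \<in> borel_measurable (N \<Otimes>\<^sub>M M)"
  shows "(\<lambda>t. Lp_norm M p (g t)) \<in> borel_measurable N"
proof -
  interpret sigma_finite_measure M by fact
  have gt[measurable]: "g t \<in> borel_measurable M" if "t \<in> space N" for t
    using measurable_compose[OF measurable_Pair1'[OF that] g] by simp
  have "(\<lambda>t. esssup M (g t)) \<in> borel_measurable N"
  proof (rule borel_measurableI_greater)
    fix c
    have level: "c < esssup M (g t) \<longleftrightarrow> emeasure M {x \<in> space M. c < g t x} \<noteq> 0" if t: "t \<in> space N" for t
    proof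
      assume "c < esssup M (g t)"
      then show "emeasure M {x \<in> space M. c < g t x} \<noteq> 0"
        using esssup_pos_measure[OF gt[OF t]] by force
    next
      assume *: "emeasure M {x \<in> space M. c < g t x} \<noteq> 0"
      show "c < esssup M (g t)"
      proof (rule ccontr)
        assume "\<not> c < esssup M (g t)"
        then have "emeasure M {x \<in> space M. c < g t x} \<le> emeasure M {x \<in> space M. esssup M (g t) < g t x}"
          using gt[OF t] by (intro emeasure_mono) auto
        with * show False by (simp add: esssup_zero_measure)
      qed
    qed
    have "{t \<in> space N. c < esssup M (g t)} =
        {t \<in> space N. (\<integral>\<^sup>+x. indicator {y. c < y} (g t x) \<partial>M) \<noteq> 0}"
    proof -
      have "emeasure M {x \<in> space M. c < g t x} = (\<integral>\<^sup>+x. indicator {y. c < y} (g t x) \<partial>M)" if t: "t \<in> space N" for t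
      proof -
        have "(\<integral>\<^sup>+x. indicator {y. c < y} (g t x) \<partial>M) = (\<integral>\<^sup>+x. indicator {x \<in> space M. c < g t x} x \<partial>M)"
          by (intro nn_integral_cong) (simp split: split_indicator)
        also have "\<dots> = emeasure M {x \<in> space M. c < g t x}"
          using gt[OF t] by (intro nn_integral_indicator) auto
        finally show ?thesis ..
      qed
      then show ?thesis using level by auto
    qed
    also have "\<dots> \<in> sets N" by measurable
    finally show "{t \<in> space N. c < esssup M (g t)} \<in> sets N" .
  qed
  moreover have "(\<lambda>t. ennreal_pow (\<integral>\<^sup>+x. ennreal_pow (g t x) b \<partial>M) c) \<in> borel_measurable N" for b c
    by measurable
  ultimately show ?thesis by (simp add: Lp_norm_def)
qed

text \<open>Truncate \<open>F\<close> at a level \<open>n\<close> that loses at most \<open>\<epsilon>/2\<close> of the integral; the truncation contributes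
  at most \<open>n\<close> times the measure of the set.\<close>

lemma nn_integral_uniformly_absolutely_continuous:
  assumes F[measurable]: "F \<in> borel_measurable M" and fin: "(\<integral>\<^sup>+x. F x \<partial>M) < \<infinity>" and "0 < \<epsilon>"
  shows "\<exists>\<eta>>0. \<forall>A\<in>sets M. emeasure M A \<le> ennreal \<eta> \<longrightarrow> (\<integral>\<^sup>+x\<in>A. F x \<partial>M) \<le> ennreal \<epsilon>"
proof -
  let ?F = "\<lambda>n x. min (F x) (of_nat n)"
  have "(\<lambda>n. \<integral>\<^sup>+x. ?F n x \<partial>M) \<longlonglongrightarrow> (\<integral>\<^sup>+x. F x \<partial>M)"
  proof (rule nn_integral_LIMSEQ)
    fix x
    show "(\<lambda>n. ?F n x) \<longlonglongrightarrow> F x"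
    proof (cases "F x")
      case (real y)
      obtain N where N: "y \<le> of_nat N" using real_arch_simple by blast
      have "eventually (\<lambda>n. F x = ?F n x) sequentially"
        using eventually_ge_at_top[of N]
      proof eventually_elim
        case (elim n)
        then have "y \<le> real n" using N by linarith
        then show ?case using real by (simp add: min_def ennreal_of_nat_eq_real_of_nat)
      qed
      then show ?thesis by (rule Lim_transform_eventually[OF tendsto_const])
    next
      case top
      then show ?thesis using of_nat_tendsto_top_ennreal by simp
    qed
  qed (auto simp: incseq_def le_fun_def min_def intro: order_trans)
  then have "(\<lambda>n. (\<integral>\<^sup>+x. ?F n x \<partial>M) + ennreal (\<epsilon> / 2)) \<longlonglongrightarrow> (\<integral>\<^sup>+x. F x \<partial>M) + ennreal (\<epsilon> / 2)"
    by (intro tendsto_add tendsto_const)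
  moreover have "(\<integral>\<^sup>+x. F x \<partial>M) < (\<integral>\<^sup>+x. F x \<partial>M) + ennreal (\<epsilon> / 2)"
    using fin \<open>0 < \<epsilon>\<close> by (cases "\<integral>\<^sup>+x. F x \<partial>M") (auto simp flip: ennreal_plus intro: ennreal_lessI)
  ultimately obtain n where n: "(\<integral>\<^sup>+x. F x \<partial>M) < (\<integral>\<^sup>+x. ?F n x \<partial>M) + ennreal (\<epsilon> / 2)"
    using order_tendstoD(1) eventually_sequentially by (metis (mono_tags, lifting) order_refl)
  have "(\<integral>\<^sup>+x. F x - ?F n x \<partial>M) = (\<integral>\<^sup>+x. F x \<partial>M) - (\<integral>\<^sup>+x. ?F n x \<partial>M)"
    by (rule nn_integral_diff)
       (use fin le_less_trans[OF nn_integral_mono[of M "?F n" F] fin] in auto)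
  also have "\<dots> \<le> ennreal (\<epsilon> / 2)"
    using n fin by (auto simp: ennreal_minus_le_iff)
  finally have rest: "(\<integral>\<^sup>+x. F x - ?F n x \<partial>M) \<le> ennreal (\<epsilon> / 2)" .
  define \<eta> where "\<eta> = \<epsilon> / 2 / (real n + 1)"
  have \<eta>: "\<eta> > 0" "real n * \<eta> \<le> \<epsilon> / 2" using \<open>0 < \<epsilon>\<close> by (auto simp: \<eta>_def field_simps)
  show ?thesis
  proof (intro exI[of _ \<eta>] conjI ballI impI)
    fix A assume A[measurable]: "A \<in> sets M" and small: "emeasure M A \<le> ennreal \<eta>"
    have "F x \<le> of_nat n + (F x - ?F n x)" for x
      by (cases "F x \<le> of_nat n") (auto simp: min_def add_increasing2 ennreal_minus_le_iff[THEN iffD1, OF order_refl])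
    then have "(\<integral>\<^sup>+x\<in>A. F x \<partial>M) \<le> (\<integral>\<^sup>+x. of_nat n * indicator A x + (F x - ?F n x) \<partial>M)"
      by (intro nn_integral_mono) (auto split: split_indicator)
    also have "\<dots> = of_nat n * emeasure M A + (\<integral>\<^sup>+x. F x - ?F n x \<partial>M)"
      by (simp add: nn_integral_add nn_integral_cmult)
    also have "\<dots> \<le> of_nat n * ennreal \<eta> + ennreal (\<epsilon> / 2)"
      by (intro add_mono mult_left_mono small rest) auto
    also have "\<dots> = ennreal (real n * \<eta> + \<epsilon> / 2)"
      using \<eta> \<open>0 < \<epsilon>\<close> by (simp add: ennreal_of_nat_eq_real_of_nat ennreal_mult)
    also have "\<dots> \<le> ennreal \<epsilon>"
      using \<eta> by (intro ennreal_leI) linarith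
    finally show "(\<integral>\<^sup>+x\<in>A. F x \<partial>M) \<le> ennreal \<epsilon>" .
  qed (rule \<eta>)
qed

text \<open>The norm in \<open>in_LqLr\<close>, but for a function with values in \<^typ>\<open>ennreal\<close>; the space variable and its exponent come first.\<close>

definition mixed_norm ::
  "'x::euclidean_space set \<Rightarrow> ereal \<Rightarrow> 'y::euclidean_space set \<Rightarrow> ereal \<Rightarrow> ('x \<times> 'y \<Rightarrow> ennreal) \<Rightarrow> ennreal" where
  "mixed_norm K r I q G =
     Lp_norm (restrict_space lborel I) q (\<lambda>t. Lp_norm (restrict_space lborel K) r (\<lambda>x. G (x, t)))"

lemma mixed_norm_cong:
  assumes "\<And>x t. x \<in> K \<Longrightarrow> t \<in> I \<Longrightarrow> G (x, t) = H (x, t)"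
  shows "mixed_norm K r I q G = mixed_norm K r I q H"
  unfolding mixed_norm_def by (intro Lp_norm_cong) (auto simp: space_restrict_space assms)

lemma borel_measurable_slice_norm:
  fixes G :: "'x::euclidean_space \<times> 'y::euclidean_space \<Rightarrow> ennreal"
  assumes G: "G \<in> borel_measurable borel" and K: "K \<in> sets borel"
  shows "(\<lambda>t. Lp_norm (restrict_space lborel K) r (\<lambda>x. G (x, t))) \<in> borel_measurable borel"
proof (rule borel_measurable_Lp_norm)
  show "sigma_finite_measure (restrict_space lborel K)"
    using K by (intro sigma_finite_measure_restrict_space sigma_finite_lborel) simp
  have "(\<lambda>x. x) \<in> restrict_space lborel K \<rightarrow>\<^sub>M (borel :: 'x measure)"
    by (rule measurable_restrict_space1) simp
  then have [measurable]: "(\<lambda>(t, x). (x, t)) \<in> (borel :: 'y measure) \<Otimes>\<^sub>M restrict_space lborel K \<rightarrow>\<^sub>M (borel :: ('x \<times> 'y) measure)"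
    unfolding borel_prod[symmetric] by measurable
  show "(\<lambda>(t, x). G (x, t)) \<in> borel_measurable ((borel :: 'y measure) \<Otimes>\<^sub>M restrict_space lborel K)"
    using measurable_compose[OF \<open>(\<lambda>(t, x). (x, t)) \<in> _\<close> G] by (simp add: case_prod_unfold)
qed

text \<open>Hoelder's inequality on each time slice bounds the spatial integral by the power \<open>a\<close> of the slice
  norm; a second application treats that norm as a function of time. The spatial norm is taken
  over a fixed \<open>K\<close>, but the temporal one only over \<open>I\<close>, so that it becomes small with \<open>I\<close>.\<close>

lemma nn_integral_pow_le_mixed_norm:
  fixes G :: "'x::euclidean_space \<times> 'y::euclidean_space \<Rightarrow> ennreal"
  assumes G: "G \<in> borel_measurable borel"
    and K: "K \<in> sets borel" and B: "B \<in> sets borel" "B \<subseteq> K" and I: "I \<in> sets borel"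
    and b: "emeasure lborel B = ennreal b" "0 < b" and l: "emeasure lborel I = ennreal l" "0 < l"
    and a: "0 < a" "ereal a \<le> r" "ereal a \<le> q"
  shows "(\<integral>\<^sup>+z\<in>B \<times> I. ennreal_pow (G z) a \<partial>lborel) \<le>
    ennreal (b powr (1 - a * real_of_ereal (inverse r)) * l powr (1 - a * real_of_ereal (inverse q)))
      * ennreal_pow (mixed_norm K r I q G) a"
proof -
  let ?K = "restrict_space lborel K" and ?I = "restrict_space lborel I"
  define N where "N = (\<lambda>t. Lp_norm ?K r (\<lambda>x. G (x, t)))"
  note [measurable] = G B(1) I
  have [measurable]: "B \<times> I \<in> sets borel"
    unfolding borel_prod[symmetric] by simp
  have N[measurable]: "N \<in> borel_measurable borel"
    unfolding N_def by (rule borel_measurable_slice_norm[OF G K])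
  have NI: "N \<in> borel_measurable ?I"
    by (rule measurable_restrict_space1) simp
  have [measurable]: "(\<lambda>x. G (x, t)) \<in> borel_measurable borel" for t
    using measurable_compose[of "\<lambda>x. (x, t)" borel borel G ennreal_borel] G by simp
  have slice: "(\<integral>\<^sup>+x\<in>B. ennreal_pow (G (x, t)) a \<partial>lborel) \<le>
      ennreal (b powr (1 - a * real_of_ereal (inverse r))) * ennreal_pow (N t) a" for t
  proof -
    have "(\<integral>\<^sup>+x\<in>B. ennreal_pow (G (x, t)) a \<partial>lborel) = (\<integral>\<^sup>+x\<in>B. ennreal_pow (G (x, t)) a \<partial>?K)"
      using K B(2) by (subst nn_integral_restrict_space) (auto intro!: nn_integral_cong split: split_indicator)
    also have "\<dots> \<le> ennreal (b powr (1 - a * real_of_ereal (inverse r))) * ennreal_pow (N t) a"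
      unfolding N_def
    proof (rule nn_integral_pow_le_Lp_norm)
      show "(\<lambda>x. G (x, t)) \<in> borel_measurable ?K"
        by (rule measurable_restrict_space1) simp
      show "B \<in> sets ?K" using B K by (subst sets_restrict_space_iff) auto
      show "emeasure ?K B = ennreal b" using B K b by (subst emeasure_restrict_space) auto
    qed (use b a in auto)
    finally show ?thesis .
  qed
  have "(\<integral>\<^sup>+z\<in>B \<times> I. ennreal_pow (G z) a \<partial>lborel) =
      (\<integral>\<^sup>+t. (\<integral>\<^sup>+x. ennreal_pow (G (x, t)) a * indicator (B \<times> I) (x, t) \<partial>lborel) \<partial>lborel)"
    unfolding lborel_prod[symmetric]
    by (subst lborel_pair.nn_integral_snd[symmetric]) (simp_all add: lborel_prod)
  also have "\<dots> = (\<integral>\<^sup>+t. (\<integral>\<^sup>+x\<in>B. ennreal_pow (G (x, t)) a \<partial>lborel) * indicator I t \<partial>lborel)"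
    by (intro nn_integral_cong) (auto simp: indicator_times split: split_indicator)
  also have "\<dots> \<le> (\<integral>\<^sup>+t. ennreal (b powr (1 - a * real_of_ereal (inverse r))) * (ennreal_pow (N t) a * indicator I t) \<partial>lborel)"
    using slice by (intro nn_integral_mono) (auto split: split_indicator)
  also have "\<dots> = ennreal (b powr (1 - a * real_of_ereal (inverse r))) * (\<integral>\<^sup>+t\<in>I. ennreal_pow (N t) a \<partial>lborel)"
    by (rule nn_integral_cmult) simp
  also have "(\<integral>\<^sup>+t\<in>I. ennreal_pow (N t) a \<partial>lborel) = (\<integral>\<^sup>+t\<in>I. ennreal_pow (N t) a \<partial>?I)"
    by (subst nn_integral_restrict_space) (auto intro!: nn_integral_cong split: split_indicator)
  also have "\<dots> \<le> ennreal (l powr (1 - a * real_of_ereal (inverse q))) * ennreal_pow (mixed_norm K r I q G) a"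
    unfolding mixed_norm_def N_def[symmetric]
  proof (rule nn_integral_pow_le_Lp_norm[OF NI])
    show "I \<in> sets ?I" by (subst sets_restrict_space_iff) auto
    show "emeasure ?I I = ennreal l" using l by (subst emeasure_restrict_space) auto
  qed (use l a in auto)
  finally show ?thesis
    by (simp add: ennreal_mult mult.assoc mult_left_mono)
qed

lemma mixed_norm_mono:
  fixes G :: "'x::euclidean_space \<times> 'y::euclidean_space \<Rightarrow> ennreal"
  assumes G: "G \<in> borel_measurable borel" and K: "K \<in> sets borel"
    and I: "I \<in> sets borel" and J: "J \<in> sets borel" and "I \<subseteq> J" and q: "0 < q"
  shows "mixed_norm K r I q G \<le> mixed_norm K r J q G"
proof -
  let ?I = "restrict_space lborel I" and ?J = "restrict_space lborel J"
  define N where "N = (\<lambda>t. Lp_norm (restrict_space lborel K) r (\<lambda>x. G (x, t)))"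
  note [measurable] = I J
  have N[measurable]: "N \<in> borel_measurable borel"
    unfolding N_def by (rule borel_measurable_slice_norm[OF G K])
  have NI: "N \<in> borel_measurable ?I"
    by (rule measurable_restrict_space1) simp
  show ?thesis
  proof (cases "q = \<infinity>")
    case True
    have "AE t in ?J. N t \<le> esssup ?J N" by (rule esssup_AE)
    then have "AE t in ?I. N t \<le> esssup ?J N"
      using \<open>I \<subseteq> J\<close> by (auto simp: AE_restrict_space_iff elim: eventually_mono)
    with NI have "esssup ?I N \<le> esssup ?J N" by (rule esssup_I)
    then show ?thesis by (simp add: mixed_norm_def Lp_norm_def True N_def)
  next
    case False
    have "(\<integral>\<^sup>+t. ennreal_pow (N t) c \<partial>?I) \<le> (\<integral>\<^sup>+t. ennreal_pow (N t) c \<partial>?J)" for c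
      using \<open>I \<subseteq> J\<close>
      by (subst (1 2) nn_integral_restrict_space) (auto intro!: nn_integral_mono split: split_indicator)
    then show ?thesis using False q
      by (cases q) (auto simp: mixed_norm_def Lp_norm_def N_def intro!: ennreal_pow_mono)
  qed
qed

text \<open>For \<open>q < \<infinity>\<close> the norm over a short time interval is small uniformly in the position of the interval.
  This fails for \<open>q = \<infinity>\<close> and is the only source of the difference between finite and infinite \<open>q\<close>.\<close>

lemma mixed_norm_short_time:
  fixes G :: "'x::euclidean_space \<times> 'y::euclidean_space \<Rightarrow> ennreal"
  assumes G: "G \<in> borel_measurable borel" and K: "K \<in> sets borel" and J: "J \<in> sets borel"
    and q: "0 < q" "q < \<infinity>" and fin: "mixed_norm K r J q G < \<infinity>" and "0 < \<epsilon>"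
  shows "\<exists>\<eta>>0. \<forall>I\<in>sets borel. I \<subseteq> J \<longrightarrow> emeasure lborel I \<le> ennreal \<eta> \<longrightarrow>
    mixed_norm K r I q G \<le> ennreal \<epsilon>"
proof -
  obtain Q where Q: "q = ereal Q" "Q > 0" using q by (cases q) auto
  let ?J = "restrict_space lborel J"
  define N where "N = (\<lambda>t. Lp_norm (restrict_space lborel K) r (\<lambda>x. G (x, t)))"
  note [measurable] = J
  have N[measurable]: "N \<in> borel_measurable borel"
    unfolding N_def by (rule borel_measurable_slice_norm[OF G K])
  have NJ: "(\<lambda>t. ennreal_pow (N t) Q) \<in> borel_measurable ?J"
    by (rule measurable_restrict_space1) simp
  have mixed: "mixed_norm K r I q G = ennreal_pow (\<integral>\<^sup>+t. ennreal_pow (N t) Q \<partial>restrict_space lborel I) (1 / Q)" for I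
    by (simp add: mixed_norm_def Lp_norm_def Q N_def)
  have "(\<integral>\<^sup>+t. ennreal_pow (N t) Q \<partial>?J) < \<infinity>"
    using fin unfolding mixed by (simp add: ennreal_pow_eq_top_iff flip: less_top)
  from nn_integral_uniformly_absolutely_continuous[OF NJ this, of "\<epsilon> powr Q"] \<open>0 < \<epsilon>\<close>
  obtain \<eta> where \<eta>: "\<eta> > 0"
    "\<And>A. A \<in> sets ?J \<Longrightarrow> emeasure ?J A \<le> ennreal \<eta> \<Longrightarrow> (\<integral>\<^sup>+t\<in>A. ennreal_pow (N t) Q \<partial>?J) \<le> ennreal (\<epsilon> powr Q)"
    by auto
  show ?thesis
  proof (intro exI[of _ \<eta>] conjI ballI impI)
    fix I assume I[measurable]: "I \<in> sets borel" and IJ: "I \<subseteq> J" and small: "emeasure lborel I \<le> ennreal \<eta>"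
    have "(\<integral>\<^sup>+t. ennreal_pow (N t) Q \<partial>restrict_space lborel I) = (\<integral>\<^sup>+t\<in>I. ennreal_pow (N t) Q \<partial>?J)"
      using IJ by (subst (1 2) nn_integral_restrict_space) (auto intro!: nn_integral_cong split: split_indicator)
    also have "\<dots> \<le> ennreal (\<epsilon> powr Q)"
      using I J IJ small by (intro \<eta>) (auto simp: sets_restrict_space_iff emeasure_restrict_space)
    finally have "mixed_norm K r I q G \<le> ennreal_pow (ennreal (\<epsilon> powr Q)) (1 / Q)"
      unfolding mixed using Q by (intro ennreal_pow_mono) auto
    also have "\<dots> = ennreal \<epsilon>"
      using Q \<open>0 < \<epsilon>\<close> by (simp add: ennreal_pow_ennreal powr_powr)
    finally show "mixed_norm K r I q G \<le> ennreal \<epsilon>" .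
  qed (rule \<eta>)
qed

section \<open>Testing the local energy identity on a cylinder\<close>

text \<open>The Bochner integral of a function that is not integrable is 0, so the inequality holds for every
  function; an upper bound on the dissipation thus needs only an upper bound on its density.\<close>

lemma ennreal_integral_le_nn_integral:
  fixes f :: "'a \<Rightarrow> real"
  shows "ennreal (\<integral>x. f x \<partial>M) \<le> (\<integral>\<^sup>+x. ennreal (f x) \<partial>M)"
proof (cases "integrable M f")
  case True
  have "(\<integral>x. f x \<partial>M) \<le> (\<integral>x. max 0 (f x) \<partial>M)"
    using True by (intro integral_mono) auto
  then have "ennreal (\<integral>x. f x \<partial>M) \<le> ennreal (\<integral>x. max 0 (f x) \<partial>M)"
    by (rule ennreal_leI)
  also have "\<dots> = (\<integral>\<^sup>+x. ennreal (max 0 (f x)) \<partial>M)"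
    using True by (subst nn_integral_eq_integral) auto
  also have "\<dots> = (\<integral>\<^sup>+x. ennreal (f x) \<partial>M)"
    by (intro nn_integral_cong) (simp add: max_def ennreal_neg)
  finally show ?thesis .
qed (simp add: not_integrable_integral_eq)

text \<open>Young's inequality for the exponents \<open>3/2\<close> and \<open>3\<close>, separating pressure from velocity in a way that
  respects the scaling \<open>p \<sim> \<bar>u\<bar>\<^sup>2\<close>.\<close>

lemma mult_le_young_three:
  fixes a b :: real
  assumes "0 \<le> a" "0 \<le> b"
  shows "a * b \<le> a powr (3 / 2) + b ^ 3"
proof (cases "a \<le> b ^ 2")
  case True
  then have "a * b \<le> b ^ 2 * b" using assms by (intro mult_right_mono)
  then show ?thesis using assms by (simp add: power3_eq_cube power2_eq_square add_increasing)
next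
  case False
  then have "b \<le> a powr (1 / 2)"
    using assms by (auto simp: powr_half_sqrt intro: real_le_rsqrt)
  then have "a * b \<le> a powr 1 * a powr (1 / 2)"
    using assms by (auto intro!: mult_left_mono)
  also have "\<dots> = a powr (3 / 2)"
    unfolding powr_add[symmetric] by simp
  also have "\<dots> \<le> a powr (3 / 2) + b ^ 3" using assms by simp
  finally show ?thesis .
qed

lemma closed_double_cylinder: "closed (double_cylinder \<alpha> \<delta> z)" and
  compact_double_cylinder: "compact (double_cylinder \<alpha> \<delta> z)"
  unfolding double_cylinder_def by (auto intro: closed_Times compact_Times)

lemma aniso_cylinder_subset_double:
  assumes "0 < \<delta>" shows "aniso_cylinder \<alpha> \<delta> z \<subseteq> double_cylinder \<alpha> \<delta> z"
  using assms by (auto simp: aniso_cylinder_def double_cylinder_def dist_real_def)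

text \<open>The pointwise form of the local energy estimate. Here \<open>a\<close>, \<open>g\<close>, \<open>l\<close> and \<open>\<phi>\<close> stand for the time
  derivative, gradient, Laplacian and value of the test function, \<open>G\<close> for the squared norm of the
  velocity gradient, and \<open>A\<close>, \<open>b\<close>, \<open>k\<close> for the respective powers of the radius.\<close>

lemma energy_density_le:
  fixes u g :: "real^'d" and P A b a l M k \<nu> G \<phi> :: real
  assumes "\<nu> > 0" "M \<ge> 0" "0 \<le> A" "0 \<le> b" "0 \<le> k"
    and "\<bar>a\<bar> \<le> M * A" "norm g \<le> M * b" "\<bar>l\<bar> \<le> M * k" "0 \<le> G" "0 \<le> \<phi>"
  shows "(norm u)\<^sup>2 / 2 * a + ((norm u)\<^sup>2 / 2 + P) * (u \<bullet> g) + \<nu> * ((norm u)\<^sup>2 / 2) * l - \<nu> * G * \<phi>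
    \<le> (2 + \<nu>) * M * ((A + k) * (norm u)\<^sup>2 + b * ((norm u) ^ 3 + \<bar>P\<bar> powr (3 / 2)))"
proof -
  let ?n = "norm u"
  have 1: "?n\<^sup>2 / 2 * a \<le> ?n\<^sup>2 * (M * A)"
  proof -
    have "?n\<^sup>2 / 2 * a \<le> ?n\<^sup>2 / 2 * (M * A)" using assms by (intro mult_left_mono) auto
    also have "\<dots> \<le> ?n\<^sup>2 * (M * A)" using assms by (intro mult_right_mono) auto
    finally show ?thesis .
  qed
  have 3: "\<nu> * (?n\<^sup>2 / 2) * l \<le> \<nu> * ?n\<^sup>2 * (M * k)"
  proof -
    have "\<nu> * (?n\<^sup>2 / 2) * l \<le> \<nu> * (?n\<^sup>2 / 2) * (M * k)" using assms by (intro mult_left_mono) auto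
    also have "\<dots> \<le> \<nu> * ?n\<^sup>2 * (M * k)" using assms by (intro mult_right_mono) auto
    finally show ?thesis .
  qed
  have 2: "(?n\<^sup>2 / 2 + P) * (u \<bullet> g) \<le> 2 * (M * b) * (?n ^ 3 + \<bar>P\<bar> powr (3 / 2))"
  proof -
    have "(?n\<^sup>2 / 2 + P) * (u \<bullet> g) \<le> \<bar>?n\<^sup>2 / 2 + P\<bar> * \<bar>u \<bullet> g\<bar>"
      by (simp flip: abs_mult)
    also have "\<dots> \<le> (?n\<^sup>2 / 2 + \<bar>P\<bar>) * (?n * (M * b))"
      using assms abs_triangle_ineq[of "?n\<^sup>2 / 2" P] order_trans[OF Cauchy_Schwarz_ineq2[of u g] mult_left_mono[OF assms(7), of ?n]]
      by (intro mult_mono) auto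
    also have "\<dots> = (M * b) * (?n ^ 3 / 2 + \<bar>P\<bar> * ?n)"
      by (simp add: field_simps power2_eq_square power3_eq_cube)
    also have "\<dots> \<le> (M * b) * (2 * (?n ^ 3 + \<bar>P\<bar> powr (3 / 2)))"
    proof (intro mult_left_mono)
      have arith: "x / 2 + w \<le> 2 * (x + y)" if "0 \<le> x" "0 \<le> y" "w \<le> y + x" for x y w :: real
        using that by (simp add: field_simps)
      have "?n ^ 3 \<ge> 0" "\<bar>P\<bar> powr (3 / 2) \<ge> 0" by auto
      then show "?n ^ 3 / 2 + \<bar>P\<bar> * ?n \<le> 2 * (?n ^ 3 + \<bar>P\<bar> powr (3 / 2))"
        using mult_le_young_three[of "\<bar>P\<bar>" ?n, OF abs_ge_zero norm_ge_zero] by (rule arith)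
    qed (use assms in auto)
    finally show ?thesis by (simp add: mult.assoc mult.left_commute)
  qed
  have 4: "- \<nu> * G * \<phi> \<le> 0" using assms by (simp add: mult_nonneg_nonneg)
  have "?n\<^sup>2 * (M * A) \<le> (2 + \<nu>) * M * (A * ?n\<^sup>2)" "\<nu> * ?n\<^sup>2 * (M * k) \<le> (2 + \<nu>) * M * (k * ?n\<^sup>2)"
    "2 * (M * b) * (?n ^ 3 + \<bar>P\<bar> powr (3 / 2)) \<le> (2 + \<nu>) * M * (b * (?n ^ 3 + \<bar>P\<bar> powr (3 / 2)))"
    using assms by (simp_all add: algebra_simps add_increasing add_increasing2)
  then have "?n\<^sup>2 * (M * A) + \<nu> * ?n\<^sup>2 * (M * k) + 2 * (M * b) * (?n ^ 3 + \<bar>P\<bar> powr (3 / 2))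
      \<le> (2 + \<nu>) * M * (A * ?n\<^sup>2) + (2 + \<nu>) * M * (k * ?n\<^sup>2) + (2 + \<nu>) * M * (b * (?n ^ 3 + \<bar>P\<bar> powr (3 / 2)))"
    by linarith
  also have "\<dots> = (2 + \<nu>) * M * ((A + k) * ?n\<^sup>2 + b * (?n ^ 3 + \<bar>P\<bar> powr (3 / 2)))"
    by (simp add: distrib_left distrib_right)
  finally show ?thesis using 1 2 3 4 by linarith
qed

text \<open>Fields are only measurable on the space-time domain. Extending by 0 makes their norm a Borel
  function on the whole space, to which Tonelli applies without restricting measures.\<close>

definition zero_extension_norm :: "'a set \<Rightarrow> ('a \<Rightarrow> 'b::real_normed_vector) \<Rightarrow> 'a \<Rightarrow> ennreal" where
  "zero_extension_norm X f z = ennreal (norm (indicator X z *\<^sub>R f z))"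

lemma zero_extension_norm_inside: "z \<in> X \<Longrightarrow> zero_extension_norm X f z = ennreal (norm (f z))"
  by (simp add: zero_extension_norm_def)

lemma borel_measurable_zero_extension_norm:
  "set_borel_measurable lborel X f \<Longrightarrow> zero_extension_norm X f \<in> borel_measurable borel"
  unfolding zero_extension_norm_def[abs_def] set_borel_measurable_def
  using borel_measurable_norm measurable_compose[OF _ measurable_ennreal] by (simp del: norm_scaleR)

text \<open>The constant comes from the adapted bump and hence does not depend on the cylinder. On the left
  the bump dominates a multiple of the indicator of the cylinder; on the right its derivatives
  live on the doubled cylinder, where the density is estimated pointwise.\<close>

lemma dissipation_cylinder_le:
  fixes \<Omega> :: "(real^'d) set" and T :: real
  defines "X \<equiv> \<Omega> \<times> {0<..<T}"
  assumes "\<nu> > 0" and diss: "dissipation_measure \<nu> \<Omega> T u Du p \<mu>"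
    and u: "set_borel_measurable lborel X u" and p: "set_borel_measurable lborel X p"
  shows "\<exists>C\<ge>0. \<forall>\<delta>>0. \<forall>z. double_cylinder \<alpha> \<delta> z \<subseteq> X \<longrightarrow>
    emeasure \<mu> (aniso_cylinder \<alpha> \<delta> z) \<le> ennreal C *
      (ennreal (\<delta> powr (- \<alpha>) + \<delta> powr (- 2)) *
         (\<integral>\<^sup>+w\<in>double_cylinder \<alpha> \<delta> z. ennreal_pow (zero_extension_norm X u w) 2 \<partial>lborel)
       + ennreal (\<delta> powr (- 1)) *
         ((\<integral>\<^sup>+w\<in>double_cylinder \<alpha> \<delta> z. ennreal_pow (zero_extension_norm X u w) 3 \<partial>lborel)
          + (\<integral>\<^sup>+w\<in>double_cylinder \<alpha> \<delta> z. ennreal_pow (zero_extension_norm X p w) (3 / 2) \<partial>lborel)))"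
proof -
  from adapted_bump[of \<alpha>] obtain M where M: "M \<ge> 0" and bump:
    "\<forall>\<delta>>0. \<forall>z. \<exists>\<phi> :: (real^'d) \<times> real \<Rightarrow> real.
    smooth \<phi> \<and> (\<forall>w. 0 \<le> \<phi> w) \<and> (\<forall>w\<in>aniso_cylinder \<alpha> \<delta> z. exp (- 2 / 3) \<le> \<phi> w) \<and>
    (\<forall>w. w \<notin> double_cylinder \<alpha> \<delta> z \<longrightarrow> \<phi> w = 0) \<and>
    (\<forall>w. \<bar>dt \<phi> w\<bar> \<le> M * \<delta> powr (- \<alpha>) * indicator (double_cylinder \<alpha> \<delta> z) w) \<and>
    (\<forall>w. norm (grad_x \<phi> w) \<le> M * \<delta> powr (- 1) * indicator (double_cylinder \<alpha> \<delta> z) w) \<and>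
    (\<forall>w. \<bar>laplacian_x \<phi> w\<bar> \<le> M * \<delta> powr (- 2) * indicator (double_cylinder \<alpha> \<delta> z) w)"
    by blast
  have [measurable]: "zero_extension_norm X u \<in> borel_measurable borel"
      "zero_extension_norm X p \<in> borel_measurable borel"
    using u p by (auto intro: borel_measurable_zero_extension_norm)
  define C0 where "C0 = (2 + \<nu>) * M"
  have C0: "C0 \<ge> 0" using M \<open>\<nu> > 0\<close> by (simp add: C0_def)
  \<comment> \<open>The factor \<open>exp (2/3)\<close> compensates the lower bound \<open>exp (- 2/3)\<close> of the bump.\<close>
  define C where "C = exp (2 / 3) * C0"
  show ?thesis
  proof (intro exI[of _ C] conjI allI impI)
    show "C \<ge> 0" using C0 by (simp add: C_def)
    fix \<delta> :: real and z :: "(real^'d) \<times> real"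
    assume \<delta>: "\<delta> > 0" and QX: "double_cylinder \<alpha> \<delta> z \<subseteq> X"
    let ?Q = "double_cylinder \<alpha> \<delta> z" and ?C = "aniso_cylinder \<alpha> \<delta> z"
    let ?A = "\<delta> powr (- \<alpha>)" and ?b = "\<delta> powr (- 1)" and ?k = "\<delta> powr (- 2)"
    from bump[rule_format, OF \<delta>, of z] obtain \<phi> :: "(real^'d) \<times> real \<Rightarrow> real" where \<phi>: "smooth \<phi>" "\<And>w. 0 \<le> \<phi> w"
      "\<And>w. w \<in> ?C \<Longrightarrow> exp (- 2 / 3) \<le> \<phi> w" "\<And>w. w \<notin> ?Q \<Longrightarrow> \<phi> w = 0"
      "\<And>w. \<bar>dt \<phi> w\<bar> \<le> M * ?A * indicator ?Q w"
      "\<And>w. norm (grad_x \<phi> w) \<le> M * ?b * indicator ?Q w"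
      "\<And>w. \<bar>laplacian_x \<phi> w\<bar> \<le> M * ?k * indicator ?Q w"
      by (elim exE conjE) (rule that; blast)
    have Q[measurable]: "?Q \<in> sets borel" by (intro borel_closed closed_double_cylinder)
    have clos: "closure {x. \<phi> x \<noteq> 0} \<subseteq> ?Q"
      using \<phi>(4) by (intro closure_minimal closed_double_cylinder) auto
    have test: "test_function X \<phi>"
      unfolding test_function_def
      using \<phi>(1) clos QX compact_Int_closed[OF compact_double_cylinder closed_closure, of \<alpha> \<delta> z "{x. \<phi> x \<noteq> 0}"]
      by (auto simp: Int_absorb1)
    have \<mu>: "sets \<mu> = sets (restrict_space borel X)" "emeasure \<mu> ?Q < \<infinity>"
      and D: "dissipation \<nu> \<Omega> T u Du p \<phi> = (LINT z|\<mu>. \<phi> z)"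
      using diss test QX compact_double_cylinder[of \<alpha> \<delta> z]
      unfolding dissipation_measure_def loc_finite_borel_measure_def X_def by auto
    have XQ: "X \<inter> ?Q \<in> sets (restrict_space borel X)" "X \<inter> ?C \<in> sets (restrict_space borel X)"
      using Q by (auto simp: sets_restrict_space aniso_cylinder_def intro!: imageI borel_open open_Times)
    have Qm: "?Q \<in> sets \<mu>" "?C \<in> sets \<mu>"
      using XQ QX aniso_cylinder_subset_double[OF \<delta>, of \<alpha> z] by (simp_all add: \<mu>(1) Int_absorb1 subset_trans)
    have \<phi>m[measurable]: "\<phi> \<in> borel_measurable borel"
      by (intro borel_measurable_continuous_onI smooth_continuous \<phi>)
    have \<phi>\<mu>: "\<phi> \<in> borel_measurable \<mu>"
      using measurable_restrict_space1[OF \<phi>m, of X] by (simp add: measurable_cong_sets[OF \<mu>(1) refl])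
    obtain N where N: "\<And>w. \<bar>\<phi> w\<bar> \<le> N"
      using smooth_bounded_of_compact_support[OF \<phi>(1) compact_double_cylinder \<phi>(4)] by blast
    have int: "integrable \<mu> \<phi>"
      by (rule integrableI_bounded_set[where A="?Q" and B=N]) (use Qm \<mu>(2) \<phi>\<mu> N \<phi>(4) in auto)
    have "ennreal (exp (- 2 / 3)) * emeasure \<mu> ?C = (\<integral>\<^sup>+w. ennreal (exp (- 2 / 3)) * indicator ?C w \<partial>\<mu>)"
      using Qm by (simp add: nn_integral_cmult_indicator)
    also have "\<dots> \<le> (\<integral>\<^sup>+w. ennreal (\<phi> w) \<partial>\<mu>)"
      using \<phi>(2,3) by (intro nn_integral_mono) (auto split: split_indicator intro: ennreal_leI)
    also have "\<dots> = ennreal (dissipation \<nu> \<Omega> T u Du p \<phi>)"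
      unfolding D using int \<phi>(2) by (intro nn_integral_eq_integral) auto
    also have "\<dots> \<le> (\<integral>\<^sup>+w. ennreal (indicator X w *\<^sub>R ((norm (u w))\<^sup>2 / 2 * dt \<phi> w
        + ((norm (u w))\<^sup>2 / 2 + p w) * (u w \<bullet> grad_x \<phi> w)
        + \<nu> * ((norm (u w))\<^sup>2 / 2) * laplacian_x \<phi> w
        - \<nu> * (norm (Du w))\<^sup>2 * \<phi> w)) \<partial>lborel)"
      unfolding dissipation_def set_lebesgue_integral_def X_def[symmetric]
      by (rule ennreal_integral_le_nn_integral)
    also have "\<dots> \<le> (\<integral>\<^sup>+w. ennreal C0 * (ennreal (?A + ?k) * (ennreal_pow (zero_extension_norm X u w) 2 * indicator ?Q w)
       + ennreal ?b * (ennreal_pow (zero_extension_norm X u w) 3 * indicator ?Q w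
          + ennreal_pow (zero_extension_norm X p w) (3 / 2) * indicator ?Q w)) \<partial>lborel)"
    proof (rule nn_integral_mono)
      fix w
      show "ennreal (indicator X w *\<^sub>R ((norm (u w))\<^sup>2 / 2 * dt \<phi> w
        + ((norm (u w))\<^sup>2 / 2 + p w) * (u w \<bullet> grad_x \<phi> w)
        + \<nu> * ((norm (u w))\<^sup>2 / 2) * laplacian_x \<phi> w
        - \<nu> * (norm (Du w))\<^sup>2 * \<phi> w)) \<le> ennreal C0 * (ennreal (?A + ?k) * (ennreal_pow (zero_extension_norm X u w) 2 * indicator ?Q w)
       + ennreal ?b * (ennreal_pow (zero_extension_norm X u w) 3 * indicator ?Q w
          + ennreal_pow (zero_extension_norm X p w) (3 / 2) * indicator ?Q w))"
      proof (cases "w \<in> ?Q")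
        case True
        then have w: "w \<in> X" using QX by blast
        have "(norm (u w))\<^sup>2 / 2 * dt \<phi> w
          + ((norm (u w))\<^sup>2 / 2 + p w) * (u w \<bullet> grad_x \<phi> w)
          + \<nu> * ((norm (u w))\<^sup>2 / 2) * laplacian_x \<phi> w
          - \<nu> * (norm (Du w))\<^sup>2 * \<phi> w
          \<le> C0 * ((?A + ?k) * (norm (u w))\<^sup>2 + ?b * ((norm (u w)) ^ 3 + \<bar>p w\<bar> powr (3 / 2)))"
          unfolding C0_def using \<phi>(5)[of w] \<phi>(6)[of w] \<phi>(7)[of w] True M \<open>\<nu> > 0\<close> \<phi>(2)
          by (intro energy_density_le) auto
        then have "ennreal ((norm (u w))\<^sup>2 / 2 * dt \<phi> w
          + ((norm (u w))\<^sup>2 / 2 + p w) * (u w \<bullet> grad_x \<phi> w)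
          + \<nu> * ((norm (u w))\<^sup>2 / 2) * laplacian_x \<phi> w
          - \<nu> * (norm (Du w))\<^sup>2 * \<phi> w)
          \<le> ennreal (C0 * ((?A + ?k) * (norm (u w))\<^sup>2 + ?b * ((norm (u w)) ^ 3 + \<bar>p w\<bar> powr (3 / 2))))"
          by (rule ennreal_leI)
        then show ?thesis
          using True w C0
          by (simp add: zero_extension_norm_inside ennreal_pow_ennreal flip: ennreal_mult ennreal_plus)
      next
        case False
        then show ?thesis using \<phi>(4)[OF False] \<phi>(5)[of w] \<phi>(6)[of w] \<phi>(7)[of w] by simp
      qed
    qed
    also have "\<dots> = ennreal C0 *
      (ennreal (?A + ?k) * (\<integral>\<^sup>+w\<in>?Q. ennreal_pow (zero_extension_norm X u w) 2 \<partial>lborel)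
       + ennreal ?b * ((\<integral>\<^sup>+w\<in>?Q. ennreal_pow (zero_extension_norm X u w) 3 \<partial>lborel)
          + (\<integral>\<^sup>+w\<in>?Q. ennreal_pow (zero_extension_norm X p w) (3 / 2) \<partial>lborel)))" (is "_ = ennreal C0 * ?R")
      by (simp add: nn_integral_cmult nn_integral_add)
    finally have "ennreal (exp (2 / 3)) * (ennreal (exp (- 2 / 3)) * emeasure \<mu> ?C) \<le> ennreal (exp (2 / 3)) * (ennreal C0 * ?R)"
      by (rule mult_left_mono) simp
    then show "emeasure \<mu> ?C \<le> ennreal C * ?R"
      using C0 by (simp add: C_def ennreal_mult mult.assoc[symmetric] flip: exp_add)
        (simp flip: ennreal_mult exp_add)
  qed
qed

section \<open>Anisotropic Hausdorff measures\<close>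

lemma ennreal_eq_0_of_small:
  fixes x :: ennreal
  assumes "\<And>e. 0 < e \<Longrightarrow> x \<le> ennreal (C * e)" "0 \<le> C"
  shows "x = 0"
proof -
  have "x \<le> 0"
  proof (rule ennreal_le_epsilon)
    fix e :: real assume "0 < e"
    have "x \<le> ennreal (C * (e / (C + 1)))"
      using \<open>0 < e\<close> assms(2) by (intro assms(1)) auto
    also have "\<dots> \<le> ennreal e"
      using \<open>0 < e\<close> assms(2) by (intro ennreal_leI) (simp add: field_simps)
    finally show "x \<le> 0 + ennreal e" by simp
  qed
  then show ?thesis by simp
qed

lemma aniso_premeasure_antimono:
  "\<rho> \<le> \<rho>' \<Longrightarrow> aniso_premeasure \<alpha> s \<rho>' A \<le> aniso_premeasure \<alpha> s \<rho> A"
  unfolding aniso_premeasure_def by (intro Inf_superset_mono) (blast intro: order_trans)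

lemma aniso_premeasure_mono:
  "A \<subseteq> B \<Longrightarrow> aniso_premeasure \<alpha> s \<rho> A \<le> aniso_premeasure \<alpha> s \<rho> B"
  unfolding aniso_premeasure_def by (intro Inf_superset_mono) (blast intro: subset_trans)

text \<open>The premeasure increases as \<open>\<rho>\<close> decreases, so the limit at 0 exists and is the supremum.\<close>

lemma aniso_hausdorff_eq_SUP:
  "aniso_hausdorff \<alpha> s A = (SUP \<rho>\<in>{0<..}. aniso_premeasure \<alpha> s \<rho> A)"
  unfolding aniso_hausdorff_def
proof (rule tendsto_Lim)
  show "((\<lambda>\<rho>. aniso_premeasure \<alpha> s \<rho> A) \<longlongrightarrow> (SUP \<rho>\<in>{0<..}. aniso_premeasure \<alpha> s \<rho> A)) (at_right 0)"
  proof (rule order_tendstoI)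
    fix a assume "a < (SUP \<rho>\<in>{0<..}. aniso_premeasure \<alpha> s \<rho> A)"
    then obtain \<rho>0 where \<rho>0: "\<rho>0 > 0" "a < aniso_premeasure \<alpha> s \<rho>0 A" by (auto simp: less_SUP_iff)
    have "a < aniso_premeasure \<alpha> s \<rho> A" if "\<rho> < \<rho>0" for \<rho>
      using \<rho>0(2) aniso_premeasure_antimono[of \<rho> \<rho>0] that by (auto intro: less_le_trans)
    then show "eventually (\<lambda>\<rho>. a < aniso_premeasure \<alpha> s \<rho> A) (at_right 0)"
      using \<rho>0(1) by (auto simp: eventually_at_right_field)
  next
    fix a assume a: "(SUP \<rho>\<in>{0<..}. aniso_premeasure \<alpha> s \<rho> A) < a"
    have "aniso_premeasure \<alpha> s \<rho> A < a" if "\<rho> > 0" for \<rho>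
      by (rule le_less_trans[OF SUP_upper a]) (use that in simp)
    then show "eventually (\<lambda>\<rho>. aniso_premeasure \<alpha> s \<rho> A < a) (at_right 0)"
      by (auto simp: eventually_at_right_field intro!: exI[of _ 1])
  qed
qed simp

lemma aniso_premeasure_le_hausdorff: "0 < \<rho> \<Longrightarrow> aniso_premeasure \<alpha> s \<rho> A \<le> aniso_hausdorff \<alpha> s A"
  unfolding aniso_hausdorff_eq_SUP by (intro SUP_upper) simp

lemma aniso_hausdorff_mono: "A \<subseteq> B \<Longrightarrow> aniso_hausdorff \<alpha> s A \<le> aniso_hausdorff \<alpha> s B"
  unfolding aniso_hausdorff_eq_SUP by (intro SUP_mono) (auto intro: aniso_premeasure_mono)

text \<open>Covers are controlled by the diameter of their cylinders, the estimates by the radius.\<close>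

lemma radius_le_diameter_cylinder:
  assumes "0 < r"
  shows "r \<le> diameter (aniso_cylinder \<alpha> r (z :: (real^'d) \<times> real))"
proof -
  fix i :: 'd
  \<comment> \<open>Two points at distance \<open>r\<close>, both at distance \<open>r / 2\<close> from the centre in a coordinate direction.\<close>
  define h :: "real^'d" where "h = (r / 2) *\<^sub>R axis i 1"
  have h: "norm h = r / 2" using assms by (simp add: h_def norm_axis_1)
  have "bounded (aniso_cylinder \<alpha> r z)"
    unfolding aniso_cylinder_def by (intro bounded_Times bounded_ball bounded_subset[OF bounded_closed_interval[of "snd z - r powr \<alpha>" "snd z + r powr \<alpha>"]]) auto
  moreover have "(fst z + h, snd z) \<in> aniso_cylinder \<alpha> r z" "(fst z - h, snd z) \<in> aniso_cylinder \<alpha> r z"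
    using assms h by (auto simp: aniso_cylinder_def dist_norm)
  ultimately have "dist (fst z + h, snd z) (fst z - h, snd z) \<le> diameter (aniso_cylinder \<alpha> r z)"
    by (rule diameter_bounded_bound)
  moreover have "dist (fst z + h, snd z) (fst z - h, snd z) = 2 * norm h"
    by (simp add: dist_Pair_Pair dist_norm scaleR_2[symmetric])
  ultimately show ?thesis using h by simp
qed

text \<open>Only covers by cylinders of radius at most 1 matter, and for those \<open>r\<^sup>s\<close> decreases in \<open>s\<close>.\<close>

lemma aniso_hausdorff_zero_mono:
  fixes A :: "((real^'d) \<times> real) set"
  assumes "s \<le> s'" "aniso_hausdorff \<alpha> s A = 0"
  shows "aniso_hausdorff \<alpha> s' A = 0"
proof -
  have small: "aniso_premeasure \<alpha> s' \<rho> A \<le> aniso_premeasure \<alpha> s \<rho> A" if "\<rho> \<le> 1" for \<rho>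
    unfolding aniso_premeasure_def
  proof (rule Inf_mono, clarify)
    fix I :: "nat set" and r and z :: "nat \<Rightarrow> (real^'d) \<times> real"
    assume *: "\<forall>i\<in>I. 0 < r i \<and> diameter (aniso_cylinder \<alpha> (r i) (z i)) \<le> \<rho>"
      "A \<subseteq> (\<Union>i\<in>I. aniso_cylinder \<alpha> (r i) (z i))"
    have "ennreal (r i powr s') \<le> ennreal (r i powr s)" if "i \<in> I" for i
    proof (rule ennreal_leI)
      have "r i \<le> 1" using * that \<open>\<rho> \<le> 1\<close> radius_le_diameter_cylinder[of "r i" \<alpha> "z i"] by force
      then show "r i powr s' \<le> r i powr s" using * that assms(1) by (intro powr_mono') auto
    qed
    then have "(\<Sum>\<^sub>\<infinity>i\<in>I. ennreal (r i powr s')) \<le> (\<Sum>\<^sub>\<infinity>i\<in>I. ennreal (r i powr s))"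
      by (intro infsum_mono nonneg_summable_on_complete) auto
    with * show "\<exists>a\<in>{(\<Sum>\<^sub>\<infinity>i\<in>I. ennreal (r i powr s')) |(I::nat set) r z.
         (\<forall>i\<in>I. 0 < r i \<and> diameter (aniso_cylinder \<alpha> (r i) (z i)) \<le> \<rho>) \<and> A \<subseteq> (\<Union>i\<in>I. aniso_cylinder \<alpha> (r i) (z i))}.
         a \<le> (\<Sum>\<^sub>\<infinity>i\<in>I. ennreal (r i powr s))" by blast
  qed
  have "aniso_premeasure \<alpha> s' \<rho> A \<le> 0" if "\<rho> > 0" for \<rho>
  proof -
    have "aniso_premeasure \<alpha> s' \<rho> A \<le> aniso_premeasure \<alpha> s' (min \<rho> 1) A"
      by (rule aniso_premeasure_antimono) simp
    also have "\<dots> \<le> aniso_premeasure \<alpha> s (min \<rho> 1) A" by (rule small) simp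
    also have "\<dots> \<le> 0" using aniso_premeasure_le_hausdorff[of "min \<rho> 1" \<alpha> s A] assms(2) that by simp
    finally show ?thesis .
  qed
  then show ?thesis unfolding aniso_hausdorff_eq_SUP by (auto intro!: antisym SUP_least)
qed

lemma suminf_indicator_eq_infsum:
  fixes f :: "nat \<Rightarrow> ennreal"
  shows "(\<Sum>i. f i * indicator I i) = (\<Sum>\<^sub>\<infinity>i\<in>I. f i)"
proof -
  have "((\<lambda>i. f i * indicator I i) has_sum (\<Sum>\<^sub>\<infinity>i. f i * indicator I i)) UNIV"
    by (intro has_sum_infsum nonneg_summable_on_complete) simp
  then have "(\<Sum>i. f i * indicator I i) = (\<Sum>\<^sub>\<infinity>i. f i * indicator I i)"
    by (intro sums_unique[symmetric] has_sum_imp_sums)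
  also have "\<dots> = (\<Sum>\<^sub>\<infinity>i\<in>I. f i)"
    by (rule infsum_cong_neutral) auto
  finally show ?thesis .
qed

text \<open>The cylinders of a cover that miss \<open>B\<close> can be discarded; the others lie in \<open>X\<close>, and countable
  subadditivity applied to them gives the bound. The growth condition is only asked of cylinders
  that meet \<open>B\<close> because cylinders elsewhere may leave \<open>X\<close>.\<close>

lemma mass_distribution:
  fixes \<mu> :: "((real^'d) \<times> real) measure"
  assumes sets: "sets \<mu> = sets (restrict_space borel X)" and X: "X \<in> sets borel"
    and B: "B \<in> sets \<mu>"
    and cyl: "\<And>\<delta> z. 0 < \<delta> \<Longrightarrow> \<delta> \<le> \<rho> \<Longrightarrow> aniso_cylinder \<alpha> \<delta> z \<inter> B \<noteq> {} \<Longrightarrow>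
      aniso_cylinder \<alpha> \<delta> z \<subseteq> X \<and> emeasure \<mu> (aniso_cylinder \<alpha> \<delta> z) \<le> c * ennreal (\<delta> powr s)"
    and less: "aniso_premeasure \<alpha> s \<rho> B < L"
  shows "emeasure \<mu> B \<le> c * L"
proof -
  obtain I :: "nat set" and r and z :: "nat \<Rightarrow> (real^'d) \<times> real" where
    r: "\<And>i. i \<in> I \<Longrightarrow> 0 < r i" "\<And>i. i \<in> I \<Longrightarrow> diameter (aniso_cylinder \<alpha> (r i) (z i)) \<le> \<rho>"
    and cover: "B \<subseteq> (\<Union>i\<in>I. aniso_cylinder \<alpha> (r i) (z i))"
    and sum: "(\<Sum>\<^sub>\<infinity>i\<in>I. ennreal (r i powr s)) < L"
    using less unfolding aniso_premeasure_def Inf_less_iff by blast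
  have r\<rho>: "r i \<le> \<rho>" if "i \<in> I" for i
    using r[OF that] radius_le_diameter_cylinder[of "r i" \<alpha> "z i"] by linarith
  define F where "F = (\<lambda>i. if i \<in> I \<and> aniso_cylinder \<alpha> (r i) (z i) \<inter> B \<noteq> {}
    then aniso_cylinder \<alpha> (r i) (z i) else {})"
  have open_cyl: "aniso_cylinder \<alpha> \<delta> w \<in> sets borel" for \<delta> and w :: "(real^'d) \<times> real"
    unfolding aniso_cylinder_def by (intro borel_open open_Times) auto
  have F: "F i \<in> sets \<mu>" for i
    using cyl[of "r i" "z i"] r(1)[of i] r\<rho>[of i] open_cyl X by (auto simp: F_def sets sets_restrict_space_iff)
  have "emeasure \<mu> B \<le> emeasure \<mu> (\<Union>i. F i)"
  proof (rule emeasure_mono)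
    show "B \<subseteq> (\<Union>i. F i)"
    proof
      fix w assume "w \<in> B"
      then obtain i where "i \<in> I" "w \<in> aniso_cylinder \<alpha> (r i) (z i)" using cover by blast
      with \<open>w \<in> B\<close> have "w \<in> F i" by (auto simp: F_def)
      then show "w \<in> (\<Union>i. F i)" by blast
    qed
  qed (use F in auto)
  also have "\<dots> \<le> (\<Sum>i. emeasure \<mu> (F i))"
    using F by (intro emeasure_subadditive_countably) auto
  also have "\<dots> \<le> (\<Sum>i. c * (ennreal (r i powr s) * indicator I i))"
    using cyl r(1) r\<rho> by (intro suminf_le) (auto simp: F_def)
  also have "\<dots> = c * (\<Sum>\<^sub>\<infinity>i\<in>I. ennreal (r i powr s))"
    by (simp add: suminf_indicator_eq_infsum)
  also have "\<dots> \<le> c * L" using sum by (intro mult_left_mono) auto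
  finally show ?thesis .
qed

section \<open>The critical power of the radius\<close>

text \<open>The convention \<open>1/\<infinity> = 0\<close> brings the four cases of the definition into one formula. If both exponents
  are infinite the second bound is missing from the minimum, but then follows from the third.\<close>

lemma critical_exponent_le:
  fixes d \<alpha> :: real
  assumes "3 \<le> r" "3 \<le> q"
  defines "\<rho> \<equiv> real_of_ereal (inverse r)" and "\<kappa> \<equiv> real_of_ereal (inverse q)"
  shows "critical_exponent d \<alpha> r q \<le> d * (1 - 2 * \<rho>) - \<alpha> * (2 * \<kappa>)"
    and "critical_exponent d \<alpha> r q \<le> - 1 + d * (1 - 3 * \<rho>) + \<alpha> * (1 - 3 * \<kappa>)"
    and "critical_exponent d \<alpha> r q \<le> - 2 + d * (1 - 2 * \<rho>) + \<alpha> * (1 - 2 * \<kappa>)"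
proof -
  have frac: "(x - c) / x = 1 - c * inverse x" "(x - c) * inverse x = 1 - c * inverse x" if "3 \<le> x" for x c :: real
    using that by (simp_all add: field_simps)
  consider (fin) x y where "r = ereal x" "q = ereal y" "3 \<le> x" "3 \<le> y"
    | (rinf) y where "r = \<infinity>" "q = ereal y" "3 \<le> y"
    | (qinf) x where "r = ereal x" "q = \<infinity>" "3 \<le> x"
    | (inf) "r = \<infinity>" "q = \<infinity>"
    using assms(1,2) by (cases r; cases q) auto
  then have "critical_exponent d \<alpha> r q \<le> d * (1 - 2 * \<rho>) - \<alpha> * (2 * \<kappa>) \<and>
      critical_exponent d \<alpha> r q \<le> - 1 + d * (1 - 3 * \<rho>) + \<alpha> * (1 - 3 * \<kappa>) \<and>
      critical_exponent d \<alpha> r q \<le> - 2 + d * (1 - 2 * \<rho>) + \<alpha> * (1 - 2 * \<kappa>)"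
  proof cases
    case fin
    then show ?thesis by (simp add: critical_exponent_def \<rho>_def \<kappa>_def frac Let_def divide_inverse min_le_iff_disj)
  next
    case rinf
    then show ?thesis by (simp add: critical_exponent_def \<rho>_def \<kappa>_def frac Let_def divide_inverse min_le_iff_disj)
  next
    case qinf
    then show ?thesis by (simp add: critical_exponent_def \<rho>_def \<kappa>_def frac Let_def divide_inverse min_le_iff_disj)
  next
    case inf
    then show ?thesis by (simp add: critical_exponent_def \<rho>_def \<kappa>_def)
  qed
  then show "critical_exponent d \<alpha> r q \<le> d * (1 - 2 * \<rho>) - \<alpha> * (2 * \<kappa>)"
    "critical_exponent d \<alpha> r q \<le> - 1 + d * (1 - 3 * \<rho>) + \<alpha> * (1 - 3 * \<kappa>)"
    "critical_exponent d \<alpha> r q \<le> - 2 + d * (1 - 2 * \<rho>) + \<alpha> * (1 - 2 * \<kappa>)" by auto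
qed

lemma nn_integral_double_cylinder_le:
  fixes G :: "(real^'d) \<times> real \<Rightarrow> ennreal"
  assumes G: "G \<in> borel_measurable borel" and K: "K \<in> sets borel"
    and a: "0 < a" "ereal a \<le> r" "ereal a \<le> q"
  shows "\<exists>c\<ge>0. \<forall>\<delta>>0. \<forall>z. cball (fst z) (2 * \<delta>) \<subseteq> K \<longrightarrow>
    (\<integral>\<^sup>+w\<in>double_cylinder \<alpha> \<delta> z. ennreal_pow (G w) a \<partial>lborel) \<le>
    ennreal (c * \<delta> powr (real CARD('d) * (1 - a * real_of_ereal (inverse r)) + \<alpha> * (1 - a * real_of_ereal (inverse q))))
      * ennreal_pow (mixed_norm K r (cball (snd z) (2 * \<delta> powr \<alpha>)) q G) a"
proof -
  define V where "V = unit_ball_vol (real CARD('d)) * 2 ^ CARD('d)"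
  have V: "V > 0" by (simp add: V_def)
  let ?e = "1 - a * real_of_ereal (inverse r)" and ?f = "1 - a * real_of_ereal (inverse q)"
  define c where "c = V powr ?e * 4 powr ?f"
  show ?thesis
  proof (intro exI[of _ c] conjI allI impI)
    show "0 \<le> c" by (simp add: c_def)
    fix \<delta> :: real and z :: "(real^'d) \<times> real"
    assume \<delta>: "\<delta> > 0" and BK: "cball (fst z) (2 * \<delta>) \<subseteq> K"
    have eB: "emeasure lborel (cball (fst z) (2 * \<delta>)) = ennreal (V * \<delta> powr real CARD('d))"
      using \<delta> by (simp add: emeasure_cball V_def powr_realpow power_mult_distrib mult_ac)
    have eI: "emeasure lborel (cball (snd z) (2 * \<delta> powr \<alpha>)) = ennreal (4 * \<delta> powr \<alpha>)"
      by (simp add: cball_eq_atLeastAtMost)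
    have "(\<integral>\<^sup>+w\<in>double_cylinder \<alpha> \<delta> z. ennreal_pow (G w) a \<partial>lborel) \<le>
      ennreal ((V * \<delta> powr real CARD('d)) powr ?e * (4 * \<delta> powr \<alpha>) powr ?f)
      * ennreal_pow (mixed_norm K r (cball (snd z) (2 * \<delta> powr \<alpha>)) q G) a"
      unfolding double_cylinder_def
      by (rule nn_integral_pow_le_mixed_norm[OF G K _ BK _ eB _ eI _ a]) (use V \<delta> in auto)
    also have "(V * \<delta> powr real CARD('d)) powr ?e * (4 * \<delta> powr \<alpha>) powr ?f
        = c * \<delta> powr (real CARD('d) * ?e + \<alpha> * ?f)"
      using V \<delta> by (simp add: c_def powr_mult powr_powr powr_add)
    finally show "(\<integral>\<^sup>+w\<in>double_cylinder \<alpha> \<delta> z. ennreal_pow (G w) a \<partial>lborel) \<le>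
      ennreal (c * \<delta> powr (real CARD('d) * ?e + \<alpha> * ?f))
      * ennreal_pow (mixed_norm K r (cball (snd z) (2 * \<delta> powr \<alpha>)) q G) a" .
  qed
qed

lemma real_of_ereal_inverse_half:
  assumes "3 \<le> r" shows "real_of_ereal (inverse (r / 2)) = 2 * real_of_ereal (inverse r)"
  using assms by (cases r) (auto simp: divide_ereal_def field_simps)

text \<open>For radii at most 1 a larger power is smaller: this is why the minimum of the three exponents governs
  the whole estimate.\<close>

lemma powr_weight_le:
  fixes \<delta> e s c :: real
  assumes "0 < \<delta>" "\<delta> \<le> 1" "s \<le> k + e" "0 \<le> c"
  shows "\<delta> powr k * (c * \<delta> powr e) \<le> c * \<delta> powr s"
proof -
  have "\<delta> powr k * (c * \<delta> powr e) = c * \<delta> powr (k + e)" by (simp add: powr_add)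
  also have "\<dots> \<le> c * \<delta> powr s" using assms by (intro mult_left_mono powr_mono') auto
  finally show ?thesis .
qed

text \<open>The powers \<open>2\<close>, \<open>3\<close> and \<open>3/2\<close> are those in which \<open>U = \<bar>u\<bar>\<close> and \<open>P = \<bar>p\<bar>\<close> enter the energy estimate;
  the pressure is measured with halved exponents in accordance with \<open>p \<sim> \<bar>u\<bar>\<^sup>2\<close>.\<close>

definition local_size :: "(real^'d) set \<Rightarrow> ereal \<Rightarrow> ereal \<Rightarrow> ((real^'d) \<times> real \<Rightarrow> ennreal)
    \<Rightarrow> ((real^'d) \<times> real \<Rightarrow> ennreal) \<Rightarrow> real set \<Rightarrow> ennreal" where
  "local_size K r q U P I = ennreal_pow (mixed_norm K r I q U) 2 + ennreal_pow (mixed_norm K r I q U) 3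
     + ennreal_pow (mixed_norm K (r / 2) I (q / 2) P) (3 / 2)"

text \<open>Each of the three integrals over the doubled cylinder is estimated by Hoelder's inequality. Multiplied
  by the power of \<open>\<delta>\<close> from the derivative of the bump, it carries a power of \<open>\<delta>\<close> with exponent one of the
  three entries of the critical minimum, hence at least \<open>s\<close>. Here \<open>C\<close> may depend on \<open>K\<close> and the
  exponents but not on the cylinder.\<close>

lemma emeasure_cylinder_le:
  fixes \<Omega> :: "(real^'d) set" and T :: real
  defines "X \<equiv> \<Omega> \<times> {0<..<T}"
  assumes "\<nu> > 0" and diss: "dissipation_measure \<nu> \<Omega> T u Du p \<mu>"
    and u: "set_borel_measurable lborel X u" and p: "set_borel_measurable lborel X p"
    and rq: "3 \<le> r" "3 \<le> q" and s: "s = critical_exponent (real CARD('d)) \<alpha> r q"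
    and K: "K \<in> sets borel" "K \<subseteq> \<Omega>"
  shows "\<exists>C\<ge>0. \<forall>\<delta>>0. \<forall>z. \<delta> \<le> 1 \<longrightarrow> cball (fst z) (2 * \<delta>) \<subseteq> K \<longrightarrow>
    cball (snd z) (2 * \<delta> powr \<alpha>) \<subseteq> {0<..<T} \<longrightarrow>
    emeasure \<mu> (aniso_cylinder \<alpha> \<delta> z) \<le> ennreal (C * \<delta> powr s) *
      local_size K r q (zero_extension_norm X u) (zero_extension_norm X p) (cball (snd z) (2 * \<delta> powr \<alpha>))"
proof -
  let ?U = "zero_extension_norm X u" and ?P = "zero_extension_norm X p"
  have meas: "?U \<in> borel_measurable borel" "?P \<in> borel_measurable borel"
    using u p by (auto intro: borel_measurable_zero_extension_norm)
  define \<rho> where "\<rho> = real_of_ereal (inverse r)"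
  define \<kappa> where "\<kappa> = real_of_ereal (inverse q)"
  let ?d = "real CARD('d)"
  have exps: "ereal 2 \<le> r" "ereal 2 \<le> q" "ereal 3 \<le> r" "ereal 3 \<le> q" "ereal (3 / 2) \<le> r / 2" "ereal (3 / 2) \<le> q / 2"
    using rq by (cases r; cases q; auto)+
  \<comment> \<open>The integrability exponents \<open>3\<close> for the velocity and \<open>3/2\<close> for the pressure scale alike.\<close>
  have half: "1 - 3 / 2 * real_of_ereal (inverse (r / 2)) = 1 - 3 * \<rho>"
    "1 - 3 / 2 * real_of_ereal (inverse (q / 2)) = 1 - 3 * \<kappa>"
    unfolding real_of_ereal_inverse_half[OF rq(1)] real_of_ereal_inverse_half[OF rq(2)] \<rho>_def \<kappa>_def
    by simp_all
  note crit = critical_exponent_le[OF rq, of ?d \<alpha>, folded \<rho>_def \<kappa>_def, folded s]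
  obtain C0 where C0: "C0 \<ge> 0" and diss_le: "\<And>\<delta> z. \<delta> > 0 \<Longrightarrow> double_cylinder \<alpha> \<delta> z \<subseteq> X \<Longrightarrow>
    emeasure \<mu> (aniso_cylinder \<alpha> \<delta> z) \<le> ennreal C0 *
      (ennreal (\<delta> powr (- \<alpha>) + \<delta> powr (- 2)) * (\<integral>\<^sup>+w\<in>double_cylinder \<alpha> \<delta> z. ennreal_pow (?U w) 2 \<partial>lborel)
       + ennreal (\<delta> powr (- 1)) * ((\<integral>\<^sup>+w\<in>double_cylinder \<alpha> \<delta> z. ennreal_pow (?U w) 3 \<partial>lborel)
          + (\<integral>\<^sup>+w\<in>double_cylinder \<alpha> \<delta> z. ennreal_pow (?P w) (3 / 2) \<partial>lborel)))"
    using dissipation_cylinder_le[OF \<open>\<nu> > 0\<close> diss u[unfolded X_def] p[unfolded X_def], of \<alpha>]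
    unfolding X_def by blast
  obtain c2 where c2: "c2 \<ge> 0" "\<And>\<delta> z. \<delta> > 0 \<Longrightarrow> cball (fst z) (2 * \<delta>) \<subseteq> K \<Longrightarrow>
    (\<integral>\<^sup>+w\<in>double_cylinder \<alpha> \<delta> z. ennreal_pow (?U w) 2 \<partial>lborel) \<le>
    ennreal (c2 * \<delta> powr (?d * (1 - 2 * \<rho>) + \<alpha> * (1 - 2 * \<kappa>)))
      * ennreal_pow (mixed_norm K r (cball (snd z) (2 * \<delta> powr \<alpha>)) q ?U) 2"
    using nn_integral_double_cylinder_le[OF meas(1) K(1) _ exps(1,2), of \<alpha>] by (auto simp: \<rho>_def \<kappa>_def)
  obtain c3 where c3: "c3 \<ge> 0" "\<And>\<delta> z. \<delta> > 0 \<Longrightarrow> cball (fst z) (2 * \<delta>) \<subseteq> K \<Longrightarrow>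
    (\<integral>\<^sup>+w\<in>double_cylinder \<alpha> \<delta> z. ennreal_pow (?U w) 3 \<partial>lborel) \<le>
    ennreal (c3 * \<delta> powr (?d * (1 - 3 * \<rho>) + \<alpha> * (1 - 3 * \<kappa>)))
      * ennreal_pow (mixed_norm K r (cball (snd z) (2 * \<delta> powr \<alpha>)) q ?U) 3"
    using nn_integral_double_cylinder_le[OF meas(1) K(1) _ exps(3,4), of \<alpha>] by (auto simp: \<rho>_def \<kappa>_def)
  obtain c4 where c4: "c4 \<ge> 0" "\<And>\<delta> z. \<delta> > 0 \<Longrightarrow> cball (fst z) (2 * \<delta>) \<subseteq> K \<Longrightarrow>
    (\<integral>\<^sup>+w\<in>double_cylinder \<alpha> \<delta> z. ennreal_pow (?P w) (3 / 2) \<partial>lborel) \<le>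
    ennreal (c4 * \<delta> powr (?d * (1 - 3 * \<rho>) + \<alpha> * (1 - 3 * \<kappa>)))
      * ennreal_pow (mixed_norm K (r / 2) (cball (snd z) (2 * \<delta> powr \<alpha>)) (q / 2) ?P) (3 / 2)"
    using nn_integral_double_cylinder_le[OF meas(2) K(1) _ exps(5,6), of \<alpha>, unfolded half] by auto
  define c where "c = 2 * c2 + c3 + c4"
  have c: "c \<ge> 0" "2 * c2 \<le> c" "c3 \<le> c" "c4 \<le> c" using c2(1) c3(1) c4(1) by (auto simp: c_def)
  show ?thesis
  proof (intro exI[of _ "C0 * c"] conjI allI impI)
    show "C0 * c \<ge> 0" using C0 c by simp
    fix \<delta> :: real and z :: "(real^'d) \<times> real"
    assume \<delta>: "\<delta> > 0" "\<delta> \<le> 1" and BK: "cball (fst z) (2 * \<delta>) \<subseteq> K"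
      and IT: "cball (snd z) (2 * \<delta> powr \<alpha>) \<subseteq> {0<..<T}"
    let ?I = "cball (snd z) (2 * \<delta> powr \<alpha>)" and ?Q = "double_cylinder \<alpha> \<delta> z"
    let ?N2 = "ennreal_pow (mixed_norm K r ?I q ?U) 2"
    let ?N3 = "ennreal_pow (mixed_norm K r ?I q ?U) 3"
    let ?N4 = "ennreal_pow (mixed_norm K (r / 2) ?I (q / 2) ?P) (3 / 2)"
    let ?e2 = "?d * (1 - 2 * \<rho>) + \<alpha> * (1 - 2 * \<kappa>)" and ?e3 = "?d * (1 - 3 * \<rho>) + \<alpha> * (1 - 3 * \<kappa>)"
    have QX: "?Q \<subseteq> X" using BK IT K by (auto simp: double_cylinder_def X_def)
    have w2: "(\<delta> powr (- \<alpha>) + \<delta> powr (- 2)) * (c2 * \<delta> powr ?e2) \<le> c * \<delta> powr s"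
    proof -
      have "\<delta> powr (- \<alpha>) * (c2 * \<delta> powr ?e2) \<le> c2 * \<delta> powr s"
        using \<delta> c2(1) crit(1) by (intro powr_weight_le) (auto simp: algebra_simps)
      moreover have "\<delta> powr (- 2) * (c2 * \<delta> powr ?e2) \<le> c2 * \<delta> powr s"
        using \<delta> c2(1) crit(3) by (intro powr_weight_le) (auto simp: algebra_simps)
      ultimately have "(\<delta> powr (- \<alpha>) + \<delta> powr (- 2)) * (c2 * \<delta> powr ?e2) \<le> (2 * c2) * \<delta> powr s"
        by (simp add: distrib_right)
      also have "\<dots> \<le> c * \<delta> powr s" using c by (intro mult_right_mono) auto
      finally show ?thesis .
    qed
    have w3: "\<delta> powr (- 1) * (k * \<delta> powr ?e3) \<le> c * \<delta> powr s" if "0 \<le> k" "k \<le> c" for k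
    proof -
      have "\<delta> powr (- 1) * (k * \<delta> powr ?e3) \<le> k * \<delta> powr s"
        using \<delta> crit(2) that by (intro powr_weight_le) (auto simp: algebra_simps)
      also have "\<dots> \<le> c * \<delta> powr s" using that by (intro mult_right_mono) auto
      finally show ?thesis .
    qed
    have "ennreal (\<delta> powr (- \<alpha>) + \<delta> powr (- 2)) * (\<integral>\<^sup>+w\<in>?Q. ennreal_pow (?U w) 2 \<partial>lborel)
        \<le> ennreal (\<delta> powr (- \<alpha>) + \<delta> powr (- 2)) * (ennreal (c2 * \<delta> powr ?e2) * ?N2)"
      by (intro mult_left_mono c2(2)[OF \<delta>(1) BK]) simp
    also have "\<dots> = ennreal ((\<delta> powr (- \<alpha>) + \<delta> powr (- 2)) * (c2 * \<delta> powr ?e2)) * ?N2"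
      using c2(1) by (subst ennreal_mult) (auto simp: mult.assoc)
    also have "\<dots> \<le> ennreal (c * \<delta> powr s) * ?N2"
      by (intro mult_right_mono ennreal_leI w2) simp
    finally have b2: "ennreal (\<delta> powr (- \<alpha>) + \<delta> powr (- 2)) * (\<integral>\<^sup>+w\<in>?Q. ennreal_pow (?U w) 2 \<partial>lborel)
      \<le> ennreal (c * \<delta> powr s) * ?N2" .
    have "ennreal (\<delta> powr (- 1)) * (\<integral>\<^sup>+w\<in>?Q. ennreal_pow (?U w) 3 \<partial>lborel)
        \<le> ennreal (\<delta> powr (- 1)) * (ennreal (c3 * \<delta> powr ?e3) * ?N3)"
      by (intro mult_left_mono c3(2)[OF \<delta>(1) BK]) simp
    also have "\<dots> = ennreal (\<delta> powr (- 1) * (c3 * \<delta> powr ?e3)) * ?N3"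
      using c3(1) by (subst ennreal_mult) (auto simp: mult.assoc)
    also have "\<dots> \<le> ennreal (c * \<delta> powr s) * ?N3"
      by (intro mult_right_mono ennreal_leI w3 c3 c) simp
    finally have b3: "ennreal (\<delta> powr (- 1)) * (\<integral>\<^sup>+w\<in>?Q. ennreal_pow (?U w) 3 \<partial>lborel)
      \<le> ennreal (c * \<delta> powr s) * ?N3" .
    have "ennreal (\<delta> powr (- 1)) * (\<integral>\<^sup>+w\<in>?Q. ennreal_pow (?P w) (3 / 2) \<partial>lborel)
        \<le> ennreal (\<delta> powr (- 1)) * (ennreal (c4 * \<delta> powr ?e3) * ?N4)"
      by (intro mult_left_mono c4(2)[OF \<delta>(1) BK]) simp
    also have "\<dots> = ennreal (\<delta> powr (- 1) * (c4 * \<delta> powr ?e3)) * ?N4"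
      using c4(1) by (subst ennreal_mult) (auto simp: mult.assoc)
    also have "\<dots> \<le> ennreal (c * \<delta> powr s) * ?N4"
      by (intro mult_right_mono ennreal_leI w3 c4 c) simp
    finally have b4: "ennreal (\<delta> powr (- 1)) * (\<integral>\<^sup>+w\<in>?Q. ennreal_pow (?P w) (3 / 2) \<partial>lborel)
      \<le> ennreal (c * \<delta> powr s) * ?N4" .
    have "emeasure \<mu> (aniso_cylinder \<alpha> \<delta> z) \<le> ennreal C0 *
      (ennreal (\<delta> powr (- \<alpha>) + \<delta> powr (- 2)) * (\<integral>\<^sup>+w\<in>?Q. ennreal_pow (?U w) 2 \<partial>lborel)
       + ennreal (\<delta> powr (- 1)) * ((\<integral>\<^sup>+w\<in>?Q. ennreal_pow (?U w) 3 \<partial>lborel)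
          + (\<integral>\<^sup>+w\<in>?Q. ennreal_pow (?P w) (3 / 2) \<partial>lborel)))"
      by (rule diss_le[OF \<delta>(1) QX])
    also have "\<dots> \<le> ennreal C0 * (ennreal (c * \<delta> powr s) * ?N2 + (ennreal (c * \<delta> powr s) * ?N3 + ennreal (c * \<delta> powr s) * ?N4))"
      unfolding distrib_left[of "ennreal (\<delta> powr (- 1))"]
      by (intro mult_left_mono add_mono b2 b3 b4) simp
    also have "\<dots> = ennreal (C0 * c * \<delta> powr s) * local_size K r q ?U ?P ?I"
      using C0 c by (simp add: local_size_def ennreal_mult distrib_left mult.assoc add.assoc)
    finally show "emeasure \<mu> (aniso_cylinder \<alpha> \<delta> z) \<le> ennreal (C0 * c * \<delta> powr s) * local_size K r q ?U ?P ?I" .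
  qed
qed

section \<open>Null sets of the dissipation\<close>

lemma compact_neighbourhood:
  fixes A U :: "'a::euclidean_space set"
  assumes "compact A" "open U" "A \<subseteq> U"
  obtains e K where "e > 0" "compact K" "K \<subseteq> U" "\<And>x. x \<in> A \<Longrightarrow> cball x e \<subseteq> K"
proof -
  obtain e where "e > 0" "(\<Union>x\<in>A. cball x e) \<subseteq> U"
    using compact_subset_open_imp_cball_epsilon_subset[OF assms] by blast
  then show thesis
    by (intro that[of e "\<Union>x\<in>A. cball x e"] compact_minkowski_sum_cball assms(1)) auto
qed

lemma powr_le_of_le_root:
  fixes \<delta> e \<alpha> :: real
  assumes "0 < \<delta>" "\<delta> \<le> e powr (1 / \<alpha>)" "0 < \<alpha>" "0 < e"
  shows "\<delta> powr \<alpha> \<le> e"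
proof -
  have "\<delta> powr \<alpha> \<le> (e powr (1 / \<alpha>)) powr \<alpha>" using assms by (intro powr_mono2) auto
  also have "\<dots> = e" using assms by (simp add: powr_powr)
  finally show ?thesis .
qed

text \<open>The doubled cylinder stays within three radii of any point of the original one, which is why the
  distances to the boundary are divided by 3.\<close>

lemma cylinders_near_compact:
  fixes \<Omega> :: "(real^'d) set" and T :: real
  assumes "compact K0" "K0 \<subseteq> \<Omega> \<times> {0<..<T}" "open \<Omega>" "\<alpha> > 0"
  obtains K J \<rho> where "compact K" "K \<subseteq> \<Omega>" "compact J" "J \<subseteq> {0<..<T}" "0 < \<rho>" "\<rho> \<le> 1"
    "\<And>\<delta> z. 0 < \<delta> \<Longrightarrow> \<delta> \<le> \<rho> \<Longrightarrow> aniso_cylinder \<alpha> \<delta> z \<inter> K0 \<noteq> {} \<Longrightarrow>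
       cball (fst z) (2 * \<delta>) \<subseteq> K \<and> cball (snd z) (2 * \<delta> powr \<alpha>) \<subseteq> J"
proof -
  have "compact (fst ` K0)" "compact (snd ` K0)"
    using assms(1) by (auto intro!: compact_continuous_image continuous_intros)
  moreover have "fst ` K0 \<subseteq> \<Omega>" "snd ` K0 \<subseteq> {0<..<T}" using assms(2) by auto
  ultimately obtain e K f J where
    K: "e > 0" "compact K" "K \<subseteq> \<Omega>" "\<And>x. x \<in> fst ` K0 \<Longrightarrow> cball x e \<subseteq> K" and
    J: "f > 0" "compact J" "J \<subseteq> {0<..<T}" "\<And>t. t \<in> snd ` K0 \<Longrightarrow> cball t f \<subseteq> J"
    using compact_neighbourhood[of "fst ` K0" \<Omega>] compact_neighbourhood[of "snd ` K0" "{0<..<T}"] assms(3)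
    by (metis open_greaterThanLessThan)
  define \<rho> where "\<rho> = min 1 (min (e / 3) ((f / 3) powr (1 / \<alpha>)))"
  show thesis
  proof (rule that[OF K(2,3) J(2,3), of \<rho>])
    show "0 < \<rho>" "\<rho> \<le> 1" using K(1) J(1) by (auto simp: \<rho>_def)
    fix \<delta> and z :: "(real^'d) \<times> real"
    assume \<delta>: "0 < \<delta>" "\<delta> \<le> \<rho>" and "aniso_cylinder \<alpha> \<delta> z \<inter> K0 \<noteq> {}"
    then obtain w where "w \<in> aniso_cylinder \<alpha> \<delta> z" "w \<in> K0" by blast
    then have w: "w \<in> K0" "dist (fst z) (fst w) < \<delta>" "\<bar>snd z - snd w\<bar> < \<delta> powr \<alpha>"
      by (auto simp: aniso_cylinder_def)
    have "\<delta> powr \<alpha> \<le> f / 3"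
      using \<delta> J(1) assms(4) by (intro powr_le_of_le_root) (auto simp: \<rho>_def)
    then have "cball (snd z) (2 * \<delta> powr \<alpha>) \<subseteq> cball (snd w) f"
      using w(3) by (subst cball_subset_cball_iff) (auto simp: dist_real_def)
    moreover have "cball (fst z) (2 * \<delta>) \<subseteq> cball (fst w) e"
      using w(2) \<delta> by (subst cball_subset_cball_iff) (auto simp: \<rho>_def)
    ultimately show "cball (fst z) (2 * \<delta>) \<subseteq> K \<and> cball (snd z) (2 * \<delta> powr \<alpha>) \<subseteq> J"
      using K(4)[of "fst w"] J(4)[of "snd w"] w(1) by blast
  qed
qed

text \<open>The hypothesis of the mass distribution principle, as a predicate so that both regimes
  (some \<open>c\<close>, every \<open>c > 0\<close>) can be stated.\<close>

definition cylinder_growth ::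
  "((real^'d) \<times> real) measure \<Rightarrow> ((real^'d) \<times> real) set \<Rightarrow> real \<Rightarrow> real \<Rightarrow> ((real^'d) \<times> real) set \<Rightarrow> real \<Rightarrow> real \<Rightarrow> bool" where
  "cylinder_growth \<mu> X \<alpha> s B \<rho> c \<longleftrightarrow>
     (\<forall>\<delta> z. 0 < \<delta> \<longrightarrow> \<delta> \<le> \<rho> \<longrightarrow> aniso_cylinder \<alpha> \<delta> z \<inter> B \<noteq> {} \<longrightarrow>
        aniso_cylinder \<alpha> \<delta> z \<subseteq> X \<and> emeasure \<mu> (aniso_cylinder \<alpha> \<delta> z) \<le> ennreal c * ennreal (\<delta> powr s))"

lemma cylinder_growth_subset:
  "cylinder_growth \<mu> X \<alpha> s B \<rho> c \<Longrightarrow> A \<subseteq> B \<Longrightarrow> cylinder_growth \<mu> X \<alpha> s A \<rho> c"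
  unfolding cylinder_growth_def by blast

lemma emeasure_le_of_growth:
  fixes \<mu> :: "((real^'d) \<times> real) measure"
  assumes "sets \<mu> = sets (restrict_space borel X)" "X \<in> sets borel" "B \<in> sets \<mu>"
    and "cylinder_growth \<mu> X \<alpha> s B \<rho> c" "0 < \<rho>" "aniso_hausdorff \<alpha> s B < L"
  shows "emeasure \<mu> B \<le> ennreal c * L"
proof (rule mass_distribution[OF assms(1-3)])
  show "aniso_premeasure \<alpha> s \<rho> B < L"
    using aniso_premeasure_le_hausdorff[OF assms(5)] assms(6) by (rule le_less_trans)
qed (use assms(4) in \<open>unfold cylinder_growth_def, blast\<close>)

lemma null_of_growth:
  fixes \<mu> :: "((real^'d) \<times> real) measure"
  assumes "sets \<mu> = sets (restrict_space borel X)" "X \<in> sets borel" "B \<in> sets \<mu>"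
    and "cylinder_growth \<mu> X \<alpha> s B \<rho> c" "0 < \<rho>" "0 \<le> c" "aniso_hausdorff \<alpha> s B = 0"
  shows "emeasure \<mu> B = 0"
proof (rule ennreal_eq_0_of_small)
  fix e :: real assume "0 < e"
  then have "emeasure \<mu> B \<le> ennreal c * ennreal e"
    using assms by (intro emeasure_le_of_growth[OF assms(1-5)]) auto
  then show "emeasure \<mu> B \<le> ennreal (c * e)" using assms(6) \<open>0 < e\<close> by (simp add: ennreal_mult)
qed fact

text \<open>An arbitrarily small growth constant compensates for a finite, non-zero Hausdorff measure.\<close>

lemma null_of_small_growth:
  fixes \<mu> :: "((real^'d) \<times> real) measure"
  assumes "sets \<mu> = sets (restrict_space borel X)" "X \<in> sets borel" "B \<in> sets \<mu>"
    and "\<And>\<epsilon>. 0 < \<epsilon> \<Longrightarrow> \<exists>\<rho>>0. cylinder_growth \<mu> X \<alpha> s B \<rho> \<epsilon>" and fin: "aniso_hausdorff \<alpha> s B < \<infinity>"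
  shows "emeasure \<mu> B = 0"
proof -
  obtain h where h: "aniso_hausdorff \<alpha> s B = ennreal h" "0 \<le> h"
    using fin by (cases "aniso_hausdorff \<alpha> s B") auto
  show ?thesis
  proof (rule ennreal_eq_0_of_small)
    fix e :: real assume e: "0 < e"
    then obtain \<rho> where \<rho>: "\<rho> > 0" "cylinder_growth \<mu> X \<alpha> s B \<rho> e" using assms(4) by blast
    have "emeasure \<mu> B \<le> ennreal e * ennreal (h + 1)"
      by (rule emeasure_le_of_growth[OF assms(1-3) \<rho>(2,1)]) (use h in \<open>auto intro: ennreal_lessI\<close>)
    then show "emeasure \<mu> B \<le> ennreal ((h + 1) * e)" using e h by (simp add: ennreal_mult mult.commute)
  qed (use h in simp)
qed

lemma local_size_mono:
  assumes "U \<in> borel_measurable borel" "P \<in> borel_measurable borel" "K \<in> sets borel"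
    "I \<in> sets borel" "J \<in> sets borel" "I \<subseteq> J" "0 < q"
  shows "local_size K r q U P I \<le> local_size K r q U P J"
proof -
  have "0 < q / 2" using \<open>0 < q\<close> by (cases q) auto
  with assms show ?thesis
    unfolding local_size_def by (intro add_mono ennreal_pow_mono mixed_norm_mono) auto
qed

lemma local_size_short_time:
  assumes U: "U \<in> borel_measurable borel" and P: "P \<in> borel_measurable borel"
    and K: "K \<in> sets borel" and J: "J \<in> sets borel" and q: "0 < q" "q < \<infinity>"
    and fin: "mixed_norm K r J q U < \<infinity>" "mixed_norm K (r / 2) J (q / 2) P < \<infinity>" and "0 < \<epsilon>"
  shows "\<exists>\<eta>>0. \<forall>I\<in>sets borel. I \<subseteq> J \<longrightarrow> emeasure lborel I \<le> ennreal \<eta> \<longrightarrow>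
    local_size K r q U P I \<le> ennreal \<epsilon>"
proof -
  define e where "e = min 1 (\<epsilon> / 3)"
  have e: "0 < e" "e \<le> 1" "3 * e \<le> \<epsilon>" using \<open>0 < \<epsilon>\<close> by (auto simp: e_def)
  have q2: "0 < q / 2" "q / 2 < \<infinity>" using q by (cases q; auto)+
  obtain \<eta>1 where \<eta>1: "\<eta>1 > 0" "\<And>I. I \<in> sets borel \<Longrightarrow> I \<subseteq> J \<Longrightarrow> emeasure lborel I \<le> ennreal \<eta>1 \<Longrightarrow>
      mixed_norm K r I q U \<le> ennreal e"
    using mixed_norm_short_time[OF U K J q fin(1) e(1)] by blast
  obtain \<eta>2 where \<eta>2: "\<eta>2 > 0" "\<And>I. I \<in> sets borel \<Longrightarrow> I \<subseteq> J \<Longrightarrow> emeasure lborel I \<le> ennreal \<eta>2 \<Longrightarrow>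
      mixed_norm K (r / 2) I (q / 2) P \<le> ennreal e"
    using mixed_norm_short_time[OF P K J q2 fin(2) e(1)] by blast
  have pow: "ennreal_pow x b \<le> ennreal e" if "x \<le> ennreal e" "1 \<le> b" for x b
  proof -
    have "ennreal_pow x b \<le> ennreal_pow (ennreal e) b" using that by (intro ennreal_pow_mono) auto
    also have "\<dots> = ennreal (e powr b)" using e by (simp add: ennreal_pow_ennreal)
    also have "\<dots> \<le> ennreal (e powr 1)" using e that by (intro ennreal_leI powr_mono') auto
    finally show ?thesis using e by simp
  qed
  show ?thesis
  proof (intro exI[of _ "min \<eta>1 \<eta>2"] conjI ballI impI)
    fix I assume I: "I \<in> sets borel" "I \<subseteq> J" "emeasure lborel I \<le> ennreal (min \<eta>1 \<eta>2)"
    have "emeasure lborel I \<le> ennreal \<eta>1" "emeasure lborel I \<le> ennreal \<eta>2"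
      by (auto intro!: order_trans[OF I(3)] ennreal_leI)
    with I have "local_size K r q U P I \<le> ennreal e + ennreal e + ennreal e"
      unfolding local_size_def by (intro add_mono pow \<eta>1 \<eta>2) auto
    also have "\<dots> = ennreal (3 * e)" using e by (simp flip: ennreal_plus)
    also have "\<dots> \<le> ennreal \<epsilon>" using e by (intro ennreal_leI)
    finally show "local_size K r q U P I \<le> ennreal \<epsilon>" .
  qed (use \<eta>1 \<eta>2 in auto)
qed

lemma mixed_norm_zero_extension_finite:
  assumes "in_LqLr_loc {0<..<T} \<Omega> q r f" "compact K" "K \<subseteq> \<Omega>" "compact J" "J \<subseteq> {0<..<T}"
  shows "mixed_norm K r J q (zero_extension_norm (\<Omega> \<times> {0<..<T}) f) < \<infinity>"
proof -
  have "mixed_norm K r J q (zero_extension_norm (\<Omega> \<times> {0<..<T}) f) = mixed_norm K r J q (\<lambda>z. ennreal (norm (f z)))"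
    using assms by (intro mixed_norm_cong zero_extension_norm_inside) auto
  also have "\<dots> < \<infinity>"
    using assms unfolding in_LqLr_loc_def in_LqLr_def mixed_norm_def by blast
  finally show ?thesis .
qed

text \<open>Near a compact set the doubled cylinders lie in a fixed compact product \<open>K \<times> J\<close>, on which the norms
  of \<open>u\<close> and \<open>p\<close> are finite; this bounds the growth constant. If \<open>q < \<infinity>\<close>, the time interval of the
  doubled cylinder has length \<open>4 \<delta>\<^sup>\<alpha>\<close>, and the norms over such intervals become arbitrarily small.\<close>

lemma dissipation_growth:
  fixes \<Omega> :: "(real^'d) set" and T :: real
  defines "X \<equiv> \<Omega> \<times> {0<..<T}"
  assumes "\<nu> > 0" "open \<Omega>" "\<alpha> > 0" and diss: "dissipation_measure \<nu> \<Omega> T u Du p \<mu>"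
    and rq: "3 \<le> r" "3 \<le> q" and s: "s = critical_exponent (real CARD('d)) \<alpha> r q"
    and u: "in_LqLr_loc {0<..<T} \<Omega> q r u" and p: "in_LqLr_loc {0<..<T} \<Omega> (q / 2) (r / 2) p"
    and K0: "compact K0" "K0 \<subseteq> X"
  shows "\<exists>\<rho>>0. \<exists>c\<ge>0. cylinder_growth \<mu> X \<alpha> s K0 \<rho> c"
    and "q < \<infinity> \<Longrightarrow> 0 < \<epsilon> \<Longrightarrow> \<exists>\<rho>>0. cylinder_growth \<mu> X \<alpha> s K0 \<rho> \<epsilon>"
proof -
  let ?U = "zero_extension_norm X u" and ?P = "zero_extension_norm X p"
  have um: "set_borel_measurable lborel X u" and pm: "set_borel_measurable lborel X p"
    using u p by (simp_all add: in_LqLr_loc_def X_def)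
  have meas: "?U \<in> borel_measurable borel" "?P \<in> borel_measurable borel"
    using um pm by (auto intro: borel_measurable_zero_extension_norm)
  obtain K J \<rho>0 where K: "compact K" "K \<subseteq> \<Omega>" and J: "compact J" "J \<subseteq> {0<..<T}" and \<rho>0: "0 < \<rho>0" "\<rho>0 \<le> 1"
    and near: "\<And>\<delta> z. 0 < \<delta> \<Longrightarrow> \<delta> \<le> \<rho>0 \<Longrightarrow> aniso_cylinder \<alpha> \<delta> z \<inter> K0 \<noteq> {} \<Longrightarrow>
       cball (fst z) (2 * \<delta>) \<subseteq> K \<and> cball (snd z) (2 * \<delta> powr \<alpha>) \<subseteq> J"
    using cylinders_near_compact[OF K0(1) K0(2)[unfolded X_def] \<open>open \<Omega>\<close> \<open>\<alpha> > 0\<close>] by blast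
  have KJ: "K \<in> sets borel" "J \<in> sets borel" using K J by (auto intro: borel_compact)
  have fin: "mixed_norm K r J q ?U < \<infinity>" "mixed_norm K (r / 2) J (q / 2) ?P < \<infinity>"
    unfolding X_def by (intro mixed_norm_zero_extension_finite u p K J)+
  have q0: "0 < q" using rq(2) by (cases q) auto
  obtain C where C: "C \<ge> 0" "\<And>\<delta> z. \<delta> > 0 \<Longrightarrow> \<delta> \<le> 1 \<Longrightarrow> cball (fst z) (2 * \<delta>) \<subseteq> K \<Longrightarrow>
    cball (snd z) (2 * \<delta> powr \<alpha>) \<subseteq> {0<..<T} \<Longrightarrow>
    emeasure \<mu> (aniso_cylinder \<alpha> \<delta> z) \<le> ennreal (C * \<delta> powr s) *
      local_size K r q ?U ?P (cball (snd z) (2 * \<delta> powr \<alpha>))"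
    using emeasure_cylinder_le[OF \<open>\<nu> > 0\<close> diss um[unfolded X_def] pm[unfolded X_def] rq s KJ(1) K(2)]
    unfolding X_def by blast
  have growth: "cylinder_growth \<mu> X \<alpha> s K0 \<rho> (C * c)"
    if \<rho>: "\<rho> \<le> \<rho>0" and c: "0 \<le> c"
      and size: "\<And>\<delta> t. 0 < \<delta> \<Longrightarrow> \<delta> \<le> \<rho> \<Longrightarrow> cball t (2 * \<delta> powr \<alpha>) \<subseteq> J \<Longrightarrow>
        local_size K r q ?U ?P (cball t (2 * \<delta> powr \<alpha>)) \<le> ennreal c" for \<rho> c
    unfolding cylinder_growth_def
  proof (intro allI impI)
    fix \<delta> and z :: "(real^'d) \<times> real"
    assume \<delta>: "0 < \<delta>" "\<delta> \<le> \<rho>" and hit: "aniso_cylinder \<alpha> \<delta> z \<inter> K0 \<noteq> {}"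
    have sub: "cball (fst z) (2 * \<delta>) \<subseteq> K" "cball (snd z) (2 * \<delta> powr \<alpha>) \<subseteq> J"
      using near[of \<delta> z] \<delta> \<rho> hit by auto
    have "aniso_cylinder \<alpha> \<delta> z \<subseteq> double_cylinder \<alpha> \<delta> z" by (rule aniso_cylinder_subset_double[OF \<delta>(1)])
    also have "\<dots> \<subseteq> X" using sub K J unfolding double_cylinder_def X_def by blast
    finally have "aniso_cylinder \<alpha> \<delta> z \<subseteq> X" .
    moreover have "emeasure \<mu> (aniso_cylinder \<alpha> \<delta> z) \<le> ennreal (C * \<delta> powr s) *
      local_size K r q ?U ?P (cball (snd z) (2 * \<delta> powr \<alpha>))"
      using sub J \<delta> \<rho> \<rho>0 by (intro C) auto
    moreover have "\<dots> \<le> ennreal (C * \<delta> powr s) * ennreal c"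
      using size[OF \<delta> sub(2)] by (rule mult_left_mono) simp
    ultimately show "aniso_cylinder \<alpha> \<delta> z \<subseteq> X \<and>
        emeasure \<mu> (aniso_cylinder \<alpha> \<delta> z) \<le> ennreal (C * c) * ennreal (\<delta> powr s)"
      using C(1) c by (simp add: ennreal_mult mult_ac)
  qed
  have "local_size K r q ?U ?P J < \<infinity>"
    using fin unfolding local_size_def by (simp add: ennreal_pow_eq_top_iff less_top[symmetric])
  then obtain L where L: "local_size K r q ?U ?P J = ennreal L" "0 \<le> L"
    by (cases "local_size K r q ?U ?P J") auto
  have "cylinder_growth \<mu> X \<alpha> s K0 \<rho>0 (C * L)"
    by (rule growth) (auto simp flip: L(1) intro!: local_size_mono meas KJ q0 L(2))
  then show "\<exists>\<rho>>0. \<exists>c\<ge>0. cylinder_growth \<mu> X \<alpha> s K0 \<rho> c"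
    using \<rho>0(1) mult_nonneg_nonneg[OF C(1) L(2)] by blast
  assume "q < \<infinity>" "0 < \<epsilon>"
  define e where "e = \<epsilon> / (C + 1)"
  have e: "e > 0" "C * e \<le> \<epsilon>" using C(1) \<open>0 < \<epsilon>\<close> by (auto simp: e_def field_simps)
  obtain \<eta> where \<eta>: "\<eta> > 0" "\<And>I. I \<in> sets borel \<Longrightarrow> I \<subseteq> J \<Longrightarrow> emeasure lborel I \<le> ennreal \<eta> \<Longrightarrow>
      local_size K r q ?U ?P I \<le> ennreal e"
    using local_size_short_time[OF meas KJ q0 \<open>q < \<infinity>\<close> fin e(1)] by blast
  \<comment> \<open>Radii up to \<open>\<rho>\<close> give time intervals of length \<open>4 \<delta>\<^sup>\<alpha> \<le> \<eta>\<close>.\<close>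
  define \<rho> where "\<rho> = min \<rho>0 ((\<eta> / 4) powr (1 / \<alpha>))"
  have \<rho>: "\<rho> > 0" "\<rho> \<le> \<rho>0" using \<rho>0 \<eta>(1) by (auto simp: \<rho>_def)
  have "cylinder_growth \<mu> X \<alpha> s K0 \<rho> (C * e)"
  proof (rule growth[OF \<rho>(2)])
    fix \<delta> t assume \<delta>: "0 < \<delta>" "\<delta> \<le> \<rho>" and I: "cball t (2 * \<delta> powr \<alpha>) \<subseteq> J"
    have "\<delta> powr \<alpha> \<le> \<eta> / 4"
      using \<delta> \<eta>(1) \<open>\<alpha> > 0\<close> by (intro powr_le_of_le_root) (auto simp: \<rho>_def)
    then have "emeasure lborel (cball t (2 * \<delta> powr \<alpha>)) \<le> ennreal \<eta>"
      by (simp add: cball_eq_atLeastAtMost ennreal_leI)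
    then show "local_size K r q ?U ?P (cball t (2 * \<delta> powr \<alpha>)) \<le> ennreal e"
      using I by (intro \<eta>) auto
  qed (use e in simp)
  then have "cylinder_growth \<mu> X \<alpha> s K0 \<rho> \<epsilon>"
    unfolding cylinder_growth_def using e(2) by (meson ennreal_leI mult_right_mono order_trans zero_le)
  then show "\<exists>\<rho>>0. cylinder_growth \<mu> X \<alpha> s K0 \<rho> \<epsilon>" using \<rho>(1) by blast
qed

theorem theorem4p1:
  fixes \<Omega> :: "(real^'d) set"
    and u :: "(real^'d) \<times> real \<Rightarrow> real^'d"
    and Du :: "(real^'d) \<times> real \<Rightarrow> real^'d^'d"
    and p :: "(real^'d) \<times> real \<Rightarrow> real"
    and \<mu> :: "((real^'d) \<times> real) measure"
    and \<nu> T \<alpha> s :: real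
    and r q :: ereal
  assumes "\<nu> > 0" and "T > 0" and "CARD('d) \<ge> 2"
    and "smooth_domain \<Omega>"
    and "leray_hopf \<nu> \<Omega> T u Du p"
    and "dissipation_measure \<nu> \<Omega> T u Du p \<mu>"
    and "\<alpha> > 0" and "3 \<le> r" and "3 \<le> q"
    and "s = critical_exponent (real CARD('d)) \<alpha> r q"
    and "s \<ge> 0"
    and "in_LqLr_loc {0<..<T} \<Omega> q r u"
    and "in_LqLr_loc {0<..<T} \<Omega> (q / 2) (r / 2) p"
  shows
    "(q < \<infinity> \<longrightarrow>
        (\<forall>B\<in>sets borel. compact (closure B) \<and> closure B \<subseteq> \<Omega> \<times> {0<..<T} \<longrightarrow>
           aniso_hausdorff \<alpha> s B < \<infinity> \<longrightarrow> emeasure \<mu> B = 0)) \<and>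
     (q = \<infinity> \<longrightarrow>
        (\<forall>A\<in>sets borel. A \<subseteq> \<Omega> \<times> {0<..<T} \<longrightarrow>
           aniso_hausdorff \<alpha> s A = 0 \<longrightarrow> emeasure \<mu> A = 0)) \<and>
     (\<forall>S\<in>sets borel. (\<exists>A\<in>sets \<mu>. emeasure \<mu> A \<noteq> 0) \<and> concentrated_on \<mu> S \<longrightarrow>
        aniso_hausdorff_dim \<alpha> S \<ge> ereal s)"
proof -
  let ?X = "\<Omega> \<times> {0<..<T}"
  have "open \<Omega>" using assms(4) by (simp add: smooth_domain_def)
  then have "open ?X" by (intro open_Times) auto
  then have X: "?X \<in> sets borel" by simp
  have sets: "sets \<mu> = sets (restrict_space borel ?X)"
    using assms(6) by (simp add: dissipation_measure_def loc_finite_borel_measure_def)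
  have in_sets: "B \<in> sets \<mu>" if "B \<in> sets borel" "B \<subseteq> ?X" for B
    using that X by (simp add: sets sets_restrict_space_iff)
  note growth = dissipation_growth[OF assms(1) \<open>open \<Omega>\<close> assms(7,6,8,9,10,12,13)]
  \<comment> \<open>Null sets are negligible for every \<open>q\<close>, even if they reach the boundary: exhaust the domain by compact sets.\<close>
  have null: "emeasure \<mu> A = 0" if A: "A \<in> sets borel" "A \<subseteq> ?X" and H: "aniso_hausdorff \<alpha> s A = 0" for A
  proof -
    obtain C :: "nat \<Rightarrow> _" where C: "\<And>n. compact (C n)" "\<And>n. C n \<subseteq> ?X" "\<Union> (range C) = ?X"
      using open_Union_compact_subsets[OF \<open>open ?X\<close>] by metis
    have AC: "A \<inter> C n \<in> sets \<mu>" for n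
      using A borel_compact[OF C(1)] by (intro in_sets sets.Int) auto
    have "emeasure \<mu> (A \<inter> C n) = 0" for n
    proof -
      obtain \<rho> c where \<rho>: "\<rho> > 0" "c \<ge> 0" "cylinder_growth \<mu> ?X \<alpha> s (C n) \<rho> c"
        using growth(1)[OF C(1,2)] by blast
      have "aniso_hausdorff \<alpha> s (A \<inter> C n) = 0"
        using aniso_hausdorff_mono[of "A \<inter> C n" A \<alpha> s] H by simp
      then show ?thesis
        using \<rho> by (intro null_of_growth[OF sets X AC]) (auto intro: cylinder_growth_subset)
    qed
    then have "emeasure \<mu> (\<Union>n. A \<inter> C n) = 0"
      using AC by (intro emeasure_UN_eq_0) auto
    moreover have "(\<Union>n. A \<inter> C n) = A" using A(2) C(3) by auto
    ultimately show ?thesis by simp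
  qed
  show ?thesis
  proof (intro conjI impI ballI)
    fix B :: "((real^'d) \<times> real) set"
    assume "q < \<infinity>" and B: "B \<in> sets borel" "compact (closure B) \<and> closure B \<subseteq> ?X"
      and H: "aniso_hausdorff \<alpha> s B < \<infinity>"
    have "\<exists>\<rho>>0. cylinder_growth \<mu> ?X \<alpha> s B \<rho> \<epsilon>" if "0 < \<epsilon>" for \<epsilon>
      using growth(2)[of "closure B", OF _ _ \<open>q < \<infinity>\<close> that] B(2) cylinder_growth_subset closure_subset by blast
    then show "emeasure \<mu> B = 0"
      using B closure_subset[of B] by (intro null_of_small_growth[OF sets X in_sets _ H]) auto
  next
    fix A :: "((real^'d) \<times> real) set"
    assume "A \<in> sets borel" "A \<subseteq> ?X" "aniso_hausdorff \<alpha> s A = 0"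
    then show "emeasure \<mu> A = 0" by (rule null)
  next
    fix S :: "((real^'d) \<times> real) set"
    assume S: "S \<in> sets borel" and *: "(\<exists>A\<in>sets \<mu>. emeasure \<mu> A \<noteq> 0) \<and> concentrated_on \<mu> S"
    then obtain A where A: "A \<in> sets \<mu>" "emeasure \<mu> A \<noteq> 0" by blast
    show "ereal s \<le> aniso_hausdorff_dim \<alpha> S"
    proof (rule ccontr)
      assume "\<not> ereal s \<le> aniso_hausdorff_dim \<alpha> S"
      then obtain s' where s': "s' < s" "aniso_hausdorff \<alpha> s' S = 0"
        by (auto simp: aniso_hausdorff_dim_def not_le Inf_less_iff)
      have "aniso_hausdorff \<alpha> s S = 0"
        by (rule aniso_hausdorff_zero_mono[OF _ s'(2)]) (use s' in simp)
      then have "aniso_hausdorff \<alpha> s (S \<inter> ?X) = 0"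
        using aniso_hausdorff_mono[of "S \<inter> ?X" S \<alpha> s] by simp
      then have "emeasure \<mu> (S \<inter> ?X) = 0" using S X by (intro null) auto
      moreover have "A \<inter> S \<subseteq> S \<inter> ?X"
        using sets.sets_into_space[OF A(1)] sets_eq_imp_space_eq[OF sets] by (auto simp: space_restrict_space)
      moreover have "S \<inter> ?X \<in> sets \<mu>" using S X by (intro in_sets) auto
      ultimately have "emeasure \<mu> (A \<inter> S) = 0"
        using emeasure_mono[of "A \<inter> S" "S \<inter> ?X" \<mu>] by simp
      with * A show False by (simp add: concentrated_on_def)
    qed
  qed
qed

end
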